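(* Let $\delta>2$ and $K>0$, and for $t\ge0$ let $r_K^{(\delta)}(t)=E_1^{(\delta)}\big[\big(\tfrac{1}{X_t^{\delta-2}}-K\big)^+\big]$, where under $P_1^{(\delta)}$ the process $(X_t)_{t\ge0}$ is a Bessel process of dimension $\delta$ starting from $1$. Then $$\int_0^\infty r_K^{(\delta)}(t)\,dt<\infty.$$
   Context: $P_x^{(\delta)}$ (with expectation $E_x^{(\delta)}$) is the law on $C(\mathbb{R}_+,\mathbb{R}_+)$ of the Bessel process of dimension $\delta$ started at $x\ge0$, i.e. the law of $\sqrt{Z}$ where $Z$ is the unique nonnegative strong solution of $dZ_t=2\sqrt{Z_t}\,dB_t+\delta\,dt$, $Z_0=x^2$, $B$ a standard Brownian motion; $(X_t)_{t\ge0}$ is the canonical process. $a^+=\max(a,0)$. *)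

theory Defs
  imports "HOL-Probability.Probability"
begin

text \<open>Time is \<^typ>\<open>real\<close>; every process is only considered at times \<open>t \<ge> 0\<close>.\<close>

subsection \<open>Brownian motion and its augmented filtration\<close>

definition brownian_motion :: "'a measure \<Rightarrow> (real \<Rightarrow> 'a \<Rightarrow> real) \<Rightarrow> bool" where
  "brownian_motion M B \<longleftrightarrow>
     prob_space M \<and>
     (\<forall>t\<ge>0. B t \<in> borel_measurable M) \<and>
     (AE \<omega> in M. B 0 \<omega> = 0) \<and>
     (\<forall>\<omega>\<in>space M. continuous_on {0..} (\<lambda>t. B t \<omega>)) \<and>
     (\<forall>s t. 0 \<le> s \<longrightarrow> s < t \<longrightarrow>
        distributed M lborel (\<lambda>\<omega>. B t \<omega> - B s \<omega>) (normal_density 0 (sqrt (t - s)))) \<and>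
     (\<forall>(n::nat) \<tau>. 0 \<le> \<tau> 0 \<longrightarrow> (\<forall>i<n. \<tau> i < \<tau> (Suc i)) \<longrightarrow>
        prob_space.indep_vars M (\<lambda>_. borel) (\<lambda>i \<omega>. B (\<tau> (Suc i)) \<omega> - B (\<tau> i) \<omega>) {..<n})"

definition brownian_filtration :: "'a measure \<Rightarrow> (real \<Rightarrow> 'a \<Rightarrow> real) \<Rightarrow> real \<Rightarrow> 'a measure" where
  "brownian_filtration M B t =
     sigma (space M)
       ({B s -` A \<inter> space M | s A. 0 \<le> s \<and> s \<le> t \<and> A \<in> sets borel} \<union> null_sets M)"

subsection \<open>The Ito integral\<close>

text \<open>
  A simple process is given by a length \<open>n\<close>, times \<open>\<tau> 0 < \<dots> < \<tau> n\<close> and bounded values \<open>\<xi> i\<close> on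
  \<open>(\<tau> i, \<tau> (i+1)]\<close>, with \<open>\<xi> i\<close> known at time \<open>\<tau> i\<close>.
\<close>

definition simple_process ::
  "(real \<Rightarrow> 'a measure) \<Rightarrow> nat \<Rightarrow> (nat \<Rightarrow> real) \<Rightarrow> (nat \<Rightarrow> 'a \<Rightarrow> real) \<Rightarrow> bool" where
  "simple_process F n \<tau> \<xi> \<longleftrightarrow>
     0 \<le> \<tau> 0 \<and> (\<forall>i<n. \<tau> i < \<tau> (Suc i)) \<and>
     (\<forall>i<n. \<xi> i \<in> borel_measurable (F (\<tau> i)) \<and>
            (\<exists>C. \<forall>\<omega>\<in>space (F (\<tau> i)). \<bar>\<xi> i \<omega>\<bar> \<le> C))"

definition simple_value :: "nat \<Rightarrow> (nat \<Rightarrow> real) \<Rightarrow> (nat \<Rightarrow> 'a \<Rightarrow> real) \<Rightarrow> real \<Rightarrow> 'a \<Rightarrow> real" where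
  "simple_value n \<tau> \<xi> s \<omega> = (\<Sum>i<n. \<xi> i \<omega> * indicator {\<tau> i<..\<tau> (Suc i)} s)"

definition simple_integral ::
  "(real \<Rightarrow> 'a \<Rightarrow> real) \<Rightarrow> nat \<Rightarrow> (nat \<Rightarrow> real) \<Rightarrow> (nat \<Rightarrow> 'a \<Rightarrow> real) \<Rightarrow> real \<Rightarrow> 'a \<Rightarrow> real" where
  "simple_integral B n \<tau> \<xi> t \<omega> =
     (\<Sum>i<n. \<xi> i \<omega> * (B (min t (\<tau> (Suc i))) \<omega> - B (min t (\<tau> i)) \<omega>))"

definition progressively_measurable :: "(real \<Rightarrow> 'a measure) \<Rightarrow> (real \<Rightarrow> 'a \<Rightarrow> real) \<Rightarrow> bool" where
  "progressively_measurable F H \<longleftrightarrow>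
     (\<forall>t\<ge>0. (\<lambda>(s, \<omega>). H s \<omega>) \<in> borel_measurable (restrict_space borel {0..t} \<Otimes>\<^sub>M F t))"

text \<open>
  \<open>ito_integral M F B H I\<close>: the continuous process \<open>I\<close> is (a version of) \<open>\<integral>\<^sub>0\<^sup>\<cdot> H dB\<close>, for
  progressively measurable \<open>H\<close> with \<open>\<integral>\<^sub>0\<^sup>t H\<^sub>s\<^sup>2 ds < \<infinity>\<close> almost surely. It is obtained from simple
  processes \<open>H\<^sup>k\<close> with \<open>\<integral>\<^sub>0\<^sup>t (H\<^sup>k\<^sub>s - H\<^sub>s)\<^sup>2 ds \<rightarrow> 0\<close> in probability as the limit in probability
  of their integrals. The limit does not depend on the approximating sequence.
\<close>

definition ito_integral ::
  "'a measure \<Rightarrow> (real \<Rightarrow> 'a measure) \<Rightarrow> (real \<Rightarrow> 'a \<Rightarrow> real) \<Rightarrow> (real \<Rightarrow> 'a \<Rightarrow> real) \<Rightarrow>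
   (real \<Rightarrow> 'a \<Rightarrow> real) \<Rightarrow> bool" where
  "ito_integral M F B H I \<longleftrightarrow>
     progressively_measurable F H \<and>
     (AE \<omega> in M. \<forall>t\<ge>0. (\<integral>\<^sup>+ s\<in>{0..t}. ennreal ((H s \<omega>)\<^sup>2) \<partial>lborel) < \<infinity>) \<and>
     (\<forall>t\<ge>0. I t \<in> borel_measurable (F t)) \<and>
     (\<forall>\<omega>\<in>space M. continuous_on {0..} (\<lambda>t. I t \<omega>)) \<and>
     (\<exists>n \<tau> \<xi>. (\<forall>k::nat. simple_process F (n k) (\<tau> k) (\<xi> k)) \<and>
        (\<forall>t\<ge>0. \<forall>\<epsilon>>0.
           (\<lambda>k. measure M {\<omega>\<in>space M.
              (\<integral>\<^sup>+ s\<in>{0..t}. ennreal ((simple_value (n k) (\<tau> k) (\<xi> k) s \<omega> - H s \<omega>)\<^sup>2) \<partial>lborel)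
                > ennreal \<epsilon>}) \<longlonglongrightarrow> 0) \<and>
        (\<forall>t\<ge>0. \<forall>\<epsilon>>0.
           (\<lambda>k. measure M {\<omega>\<in>space M.
              \<bar>simple_integral B (n k) (\<tau> k) (\<xi> k) t \<omega> - I t \<omega>\<bar> > \<epsilon>}) \<longlonglongrightarrow> 0))"

subsection \<open>Squared Bessel processes and Bessel laws\<close>

text \<open>
  \<open>Z\<close> is a nonnegative strong solution of \<open>dZ = 2 \<surd>Z dB + \<delta> dt\<close>, \<open>Z\<^sub>0 = x\<^sup>2\<close>, driven by the
  Brownian motion \<open>B\<close>; strong means adapted to the augmented filtration of \<open>B\<close>.
\<close>

definition squared_bessel_strong_solution ::
  "'a measure \<Rightarrow> (real \<Rightarrow> 'a \<Rightarrow> real) \<Rightarrow> real \<Rightarrow> real \<Rightarrow> (real \<Rightarrow> 'a \<Rightarrow> real) \<Rightarrow> bool" where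
  "squared_bessel_strong_solution M B \<delta> x Z \<longleftrightarrow>
     brownian_motion M B \<and>
     (\<forall>t\<ge>0. Z t \<in> borel_measurable (brownian_filtration M B t)) \<and>
     (\<forall>\<omega>\<in>space M. continuous_on {0..} (\<lambda>t. Z t \<omega>) \<and> (\<forall>t\<ge>0. 0 \<le> Z t \<omega>)) \<and>
     (\<exists>I. ito_integral M (brownian_filtration M B) B (\<lambda>t \<omega>. 2 * sqrt (Z t \<omega>)) I \<and>
          (AE \<omega> in M. \<forall>t\<ge>0. Z t \<omega> = x\<^sup>2 + I t \<omega> + \<delta> * t))"

text \<open>
  \<open>C(\<real>\<^sub>+, \<real>\<^sub>+)\<close>, with functions made \<open>undefined\<close> off \<open>{0..}\<close>, and with the \<open>\<sigma>\<close>-algebra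
  generated by the coordinate maps. The canonical process is \<open>\<lambda>t w. w t\<close>.
\<close>

definition continuous_paths :: "(real \<Rightarrow> real) set" where
  "continuous_paths =
     {w \<in> extensional {0..}. continuous_on {0..} w \<and> (\<forall>t\<ge>0. 0 \<le> w t)}"

definition path_space :: "(real \<Rightarrow> real) measure" where
  "path_space = restrict_space (Pi\<^sub>M {0..} (\<lambda>_. borel)) continuous_paths"

definition sqrt_law :: "'a measure \<Rightarrow> (real \<Rightarrow> 'a \<Rightarrow> real) \<Rightarrow> (real \<Rightarrow> real) measure" where
  "sqrt_law M Z = distr M path_space (\<lambda>\<omega>. \<lambda>t\<in>{0..}. sqrt (Z t \<omega>))"

text \<open>
  \<open>P\<close> is the law of the Bessel process of dimension \<open>\<delta>\<close> started at \<open>x\<close>, realised from the strong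
  solution \<open>Z\<close> driven by \<open>B\<close> on \<open>M\<close>; by uniqueness in law it does not depend on \<open>M\<close>, \<open>B\<close>, \<open>Z\<close>.
\<close>

definition bessel_law ::
  "'a measure \<Rightarrow> (real \<Rightarrow> 'a \<Rightarrow> real) \<Rightarrow> (real \<Rightarrow> 'a \<Rightarrow> real) \<Rightarrow> real \<Rightarrow> real \<Rightarrow>
   (real \<Rightarrow> real) measure \<Rightarrow> bool" where
  "bessel_law M B Z \<delta> x P \<longleftrightarrow>
     squared_bessel_strong_solution M B \<delta> x Z \<and> P = sqrt_law M Z"

text \<open>
  The expectation takes values in \<open>[0, \<infinity>]\<close>, and \<open>1 / X\<^sub>t\<^bsup>\<delta>-2\<^esup>\<close> is formed in \<^typ>\<open>ereal\<close> so that it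
  is \<open>\<infinity>\<close> rather than \<open>0\<close> when \<open>X\<^sub>t = 0\<close>.
\<close>

definition r_fun :: "(real \<Rightarrow> real) measure \<Rightarrow> real \<Rightarrow> real \<Rightarrow> real \<Rightarrow> ennreal" where
  "r_fun P \<delta> K t =
     (\<integral>\<^sup>+ w. e2ennreal (max (1 / ereal (w t powr (\<delta> - 2)) - ereal K) 0) \<partial>P)"

subsection \<open>The law is a probability measure on path space\<close>

lemma space_brownian_filtration [simp]: "space (brownian_filtration M B t) = space M"
  unfolding brownian_filtration_def
  by (rule space_measure_of) (auto dest!: null_setsD2 sets.sets_into_space)

lemma sets_brownian_filtration_subset:
  assumes "brownian_motion M B"
  shows "sets (brownian_filtration M B t) \<subseteq> sets M"
proof -
  let ?G = "{B s -` A \<inter> space M | s A. 0 \<le> s \<and> s \<le> t \<and> A \<in> sets borel} \<union> null_sets M"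
  have G: "?G \<subseteq> sets M"
    using assms unfolding brownian_motion_def by (auto intro: measurable_sets)
  have "sets (brownian_filtration M B t) = sigma_sets (space M) ?G"
    unfolding brownian_filtration_def using G sets.space_closed[of M]
    by (intro sets_measure_of) blast
  also have "\<dots> \<subseteq> sets M"
    using G by (rule sets.sigma_sets_subset)
  finally show ?thesis .
qed

lemma measurable_sqrt_path:
  assumes "squared_bessel_strong_solution M B \<delta> x Z"
  shows "(\<lambda>\<omega>. \<lambda>t\<in>{0..}. sqrt (Z t \<omega>)) \<in> measurable M path_space"
proof -
  have BM: "brownian_motion M B"
    using assms by (simp add: squared_bessel_strong_solution_def)
  have Z: "Z t \<in> borel_measurable M" if "t \<ge> 0" for t
  proof -
    have "Z t \<in> borel_measurable (brownian_filtration M B t)"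
      using assms that by (simp add: squared_bessel_strong_solution_def)
    moreover have "measurable (brownian_filtration M B t) borel \<subseteq> borel_measurable M"
      by (rule measurable_mono) (use sets_brownian_filtration_subset[OF BM] in auto)
    ultimately show ?thesis by blast
  qed
  show ?thesis
    unfolding path_space_def
  proof (rule measurable_restrict_space2)
    show "(\<lambda>\<omega>. \<lambda>t\<in>{0..}. sqrt (Z t \<omega>)) \<in> space M \<rightarrow> continuous_paths"
    proof
      fix \<omega> assume "\<omega> \<in> space M"
      then have "continuous_on {0..} (\<lambda>t. Z t \<omega>)" "\<forall>t\<ge>0. 0 \<le> Z t \<omega>"
        using assms by (auto simp: squared_bessel_strong_solution_def)
      moreover from this(1) have "continuous_on {0..} (\<lambda>t. sqrt (Z t \<omega>))"
        by (rule continuous_on_real_sqrt)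
      then have "continuous_on {0..} (\<lambda>t\<in>{0..}. sqrt (Z t \<omega>))"
        by (rule continuous_on_eq) simp
      ultimately show "(\<lambda>t\<in>{0..}. sqrt (Z t \<omega>)) \<in> continuous_paths"
        by (simp add: continuous_paths_def)
    qed
    show "(\<lambda>\<omega>. \<lambda>t\<in>{0..}. sqrt (Z t \<omega>)) \<in> measurable M (Pi\<^sub>M {0..} (\<lambda>_. borel))"
      by (rule measurable_restrict) (use Z in auto)
  qed
qed

lemma prob_space_bessel_law:
  assumes "bessel_law M B Z \<delta> x P"
  shows "prob_space P"
proof -
  have sol: "squared_bessel_strong_solution M B \<delta> x Z" and P: "P = sqrt_law M Z"
    using assms by (auto simp: bessel_law_def)
  then interpret prob_space M
    by (simp add: squared_bessel_strong_solution_def brownian_motion_def)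
  show ?thesis
    unfolding P sqrt_law_def using measurable_sqrt_path[OF sol] by (rule prob_space_distr)
qed

end

(*
  Write Z = X^2 and nu = (delta - 2)/2. For a simple integrand H the exponential
  exp(int u H dB - 1/2 int u^2 H^2 ds), with u a deterministic step function, has expectation
  exactly 1. Hence no Ito formula is needed: passing to the limit in probability and then refining
  the step function, Fatou's lemma gives for H = 2 sqrt Z and u solving a Riccati equation the upper
  half of the Laplace transform formula,
    E exp(-l Z_t) <= (1 + 2 l t)^(-delta/2) exp(-l x^2 / (1 + 2 l t)).
  The payoff is at most a constant times Z_t^(-p) for any p >= nu, and Z_t^(-p) is at most a
  constant times int_0^infinity l^(p-1) exp(-l Z_t) dl. Choosing also 1 < p < nu + 1, the double
  integral of l^(p-1) times the Laplace bound over l and t is finite.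
*)
theory Submission
  imports Defs
begin

subsection \<open>Brownian increments and the augmented filtration\<close>

text \<open>Two constraints shape the argument. On the analytic side, E Z_t^(-p) decays only like
  t^(-p), so integrability over all times forces p > 1, while the payoff by itself has exponent nu,
  which may be at most 1. The strike K bridges the gap: the payoff vanishes unless Z_t^(-nu) > K,
  and there Z_t^(-nu) can be traded for a larger negative power. The upper limit p < nu + 1 =
  delta/2 is where negative moments cease to be finite. On the probabilistic side,
  \<open>brownian_motion\<close> grants independence of finitely many consecutive increments and
  nothing about a filtration, and \<open>ito_integral\<close> grants a limit in probability at each
  fixed time. So independence from the augmented filtration has to be derived, and stochastic
  integrals are compared at finitely many deterministic times only. The energies of the
  approximating integrands are dominated by that of the limit up to a factor 1 + \<theta> and a
  deterministic error; this one-sided comparison is the reason why an inequality, and not the exact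
  Laplace transform, comes out.\<close>

lemma brownian_filtration_mono:
  assumes "brownian_motion M B" "s \<le> t"
  shows "sets (brownian_filtration M B s) \<subseteq> sets (brownian_filtration M B t)"
proof -
  let ?G = "\<lambda>t. {B s -` A \<inter> space M | s A. 0 \<le> s \<and> s \<le> t \<and> A \<in> sets borel} \<union> null_sets M"
  have "sets (brownian_filtration M B t) = sigma_sets (space M) (?G t)" for t
    unfolding brownian_filtration_def by (rule sets_measure_of) (auto dest!: null_setsD2 sets.sets_into_space)
  moreover have "sigma_sets (space M) (?G s) \<subseteq> sigma_sets (space M) (?G t)"
  proof (rule sigma_sets_mono', rule Un_mono, rule Collect_mono, safe)
    fix r and A :: "real set" assume "0 \<le> r" "r \<le> s" "A \<in> sets borel"
    then show "\<exists>r' A'. B r -` A \<inter> space M = B r' -` A' \<inter> space M \<and> 0 \<le> r' \<and> r' \<le> t \<and> A' \<in> sets borel"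
      using assms(2) by (intro exI[of _ r] exI[of _ A]) auto
  qed
  ultimately show ?thesis by simp
qed

lemma measurable_brownian_filtration_mono:
  assumes "brownian_motion M B" "s \<le> t" "f \<in> measurable (brownian_filtration M B s) N"
  shows "f \<in> measurable (brownian_filtration M B t) N"
  using measurable_mono[of N N "brownian_filtration M B s" "brownian_filtration M B t"]
    brownian_filtration_mono[OF assms(1,2)] assms(3) by auto

lemma measurable_brownian_filtration_imp:
  assumes "brownian_motion M B" "f \<in> measurable (brownian_filtration M B s) N"
  shows "f \<in> measurable M N"
  using measurable_mono[of N N "brownian_filtration M B s" M]
    sets_brownian_filtration_subset[OF assms(1)] assms(2) by auto

lemma brownian_motion_measurable_filtration:
  assumes "0 \<le> s" "s \<le> t"
  shows "B s \<in> borel_measurable (brownian_filtration M B t)"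
proof (rule measurableI)
  fix A :: "real set" assume "A \<in> sets borel"
  then show "B s -` A \<inter> space (brownian_filtration M B t) \<in> sets (brownian_filtration M B t)"
    unfolding space_brownian_filtration unfolding brownian_filtration_def
    using assms sets.sets_into_space[of _ M]
    by (subst sets_measure_of) (blast, intro sigma_sets.Basic UnI1 CollectI exI[of _ s] exI[of _ A], simp)
qed simp

text \<open>The times of \<open>J\<close>, together with 0, \<open>a\<close> and \<open>b\<close>,
  are sorted into one grid. The values of \<open>B\<close> on the grid are partial sums of its
  increments, so the cylinder is, up to a null set, an event of the increments before
  \<open>a\<close>, and these are jointly independent of the last one.\<close>

lemma brownian_cylinder_indep:
  assumes BM: "brownian_motion M B" and ab: "0 \<le> a" "a < b"
    and J: "finite J" "J \<subseteq> {0..a}" and A: "\<And>s. s \<in> J \<Longrightarrow> A s \<in> sets borel"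
    and D: "D \<in> sets borel"
  shows "measure M ({\<omega>\<in>space M. \<forall>s\<in>J. B s \<omega> \<in> A s} \<inter> ((\<lambda>\<omega>. B b \<omega> - B a \<omega>) -` D \<inter> space M)) =
         measure M {\<omega>\<in>space M. \<forall>s\<in>J. B s \<omega> \<in> A s} * measure M ((\<lambda>\<omega>. B b \<omega> - B a \<omega>) -` D \<inter> space M)"
proof -
  interpret prob_space M using BM by (simp add: brownian_motion_def)
  have Bm[measurable]: "B t \<in> borel_measurable M" if "t \<ge> 0" for t
    using BM that by (simp add: brownian_motion_def)
  \<comment> \<open>Starting at 0 makes partial sums of increments equal to values of
    \<open>B\<close>; ending at \<open>a\<close> makes the increment up to the appended
    \<open>b\<close> the one in the claim.\<close>
  define L where "L = sorted_list_of_set (insert 0 (insert a J))"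
  have setL: "set L = insert 0 (insert a J)"
    unfolding L_def using J by (intro set_sorted_list_of_set) auto
  have srt: "sorted_wrt (<) L"
    unfolding L_def by (rule strict_sorted_list_of_set)
  define n where "n = length L - 1"
  have lenL: "length L = Suc n" using setL by (cases L) (auto simp: n_def)
  define \<tau> where "\<tau> i = (L @ [b]) ! i" for i
  have \<tau>L: "\<tau> i = L ! i" if "i \<le> n" for i
    using that lenL by (simp add: \<tau>_def nth_append)
  have \<tau>b: "\<tau> (Suc n) = b" using lenL by (simp add: \<tau>_def nth_append)
  have Lb: "x \<in> {0..a}" if "x \<in> set L" for x using that setL J ab by auto
  have srt': "sorted_wrt (<) (L @ [b])" using srt ab Lb by (fastforce simp: sorted_wrt_append)
  have \<tau>_less: "\<tau> i < \<tau> j" if "i < j" "j \<le> Suc n" for i j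
    using sorted_wrt_nth_less[OF srt', of i j] that lenL by (simp add: \<tau>_def)
  have \<tau>_le: "\<tau> i \<le> \<tau> j" if "i \<le> j" "j \<le> Suc n" for i j
    using \<tau>_less[of i j] that by (cases "i = j") auto
  have \<tau>0: "\<tau> 0 = 0"
  proof -
    obtain k where "k \<le> n" "\<tau> k = 0"
      using setL \<tau>L lenL by (metis in_set_conv_nth insertI1 less_Suc_eq_le)
    moreover have "\<tau> 0 \<ge> 0" using Lb[of "L ! 0"] \<tau>L[of 0] lenL by auto
    ultimately show ?thesis using \<tau>_le[of 0 k] by auto
  qed
  have \<tau>n: "\<tau> n = a"
  proof -
    obtain k where "k \<le> n" "\<tau> k = a"
      using setL \<tau>L lenL by (metis in_set_conv_nth insertI1 insertI2 less_Suc_eq_le)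
    moreover have "\<tau> n \<le> a" using Lb[of "L ! n"] \<tau>L[of n] lenL by auto
    ultimately show ?thesis using \<tau>_le[of k n] by auto
  qed
  have \<tau>nn: "\<tau> i \<ge> 0" if "i \<le> Suc n" for i using \<tau>_le[of 0 i] \<tau>0 that by simp
  define X where "X i \<omega> = B (\<tau> (Suc i)) \<omega> - B (\<tau> i) \<omega>" for i \<omega>
  have "indep_vars (\<lambda>_. borel) X {..<Suc n}"
    using BM \<tau>0 \<tau>_less unfolding brownian_motion_def X_def by (simp add: less_Suc_eq)
  then have iv: "indep_var (Pi\<^sub>M {..<n} (\<lambda>_. borel)) (\<lambda>\<omega>. restrict (\<lambda>i. X i \<omega>) {..<n})
        (Pi\<^sub>M {n} (\<lambda>_. borel)) (\<lambda>\<omega>. restrict (\<lambda>i. X i \<omega>) {n})"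
    by (rule indep_var_restrict) auto
  have tel: "(\<Sum>i<k. X i \<omega>) = B (\<tau> k) \<omega> - B 0 \<omega>" for k \<omega>
    using sum_lessThan_telescope[of "\<lambda>i. B (\<tau> i) \<omega>" k] by (simp add: X_def \<tau>0)
  \<comment> \<open>The inserted grid points 0 and \<open>a\<close> carry no constraint unless they
    belong to \<open>J\<close>.\<close>
  define A' where "A' k = (if \<tau> k \<in> J then A (\<tau> k) else UNIV)" for k
  have A'm[measurable]: "A' k \<in> sets borel" for k using A by (simp add: A'_def)
  define S where "S = {x\<in>space (Pi\<^sub>M {..<n} (\<lambda>_. borel)). \<forall>k\<in>{..n}. (\<Sum>i<k. x i) \<in> A' k}"
  have Sm: "S \<in> sets (Pi\<^sub>M {..<n} (\<lambda>_. borel :: real measure))"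
  proof -
    have "{x\<in>space (Pi\<^sub>M {..<n} (\<lambda>_. borel)). (\<Sum>i<k. x i) \<in> A' k} \<in> sets (Pi\<^sub>M {..<n} (\<lambda>_. borel :: real measure))"
      if "k \<in> {..n}" for k
    proof -
      have [measurable]: "(\<lambda>x. \<Sum>i<k. x i) \<in> borel_measurable (Pi\<^sub>M {..<n} (\<lambda>_. borel :: real measure))"
        using that by (intro borel_measurable_sum measurable_component_singleton) auto
      show ?thesis by measurable
    qed
    then show ?thesis unfolding S_def by (intro sets.sets_Collect_finite_All) auto
  qed
  define T where "T = {y\<in>space (Pi\<^sub>M {n} (\<lambda>_. borel)). y n \<in> D}"
  have Tm: "T \<in> sets (Pi\<^sub>M {n} (\<lambda>_. borel :: real measure))"
    using D unfolding T_def by measurable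
  let ?C = "{\<omega>\<in>space M. \<forall>s\<in>J. B s \<omega> \<in> A s}" and ?D = "(\<lambda>\<omega>. B b \<omega> - B a \<omega>) -` D \<inter> space M"
  let ?C' = "(\<lambda>\<omega>. restrict (\<lambda>i. X i \<omega>) {..<n}) -` S \<inter> space M"
  have C'm: "?C' \<in> events"
    using iv Sm by (intro measurable_sets[of _ _ "Pi\<^sub>M {..<n} (\<lambda>_. borel)"]) (auto simp: indep_var_eq)
  have Cm: "?C \<in> events"
  proof (intro sets.sets_Collect_finite_All)
    fix s assume "s \<in> J"
    then show "{\<omega>\<in>space M. B s \<omega> \<in> A s} \<in> events"
      using J A[of s] Bm[of s] by (auto simp: measurable_def vimage_def Int_def conj_commute)
  qed (use J in auto)
  have Dm: "?D \<in> events" using D Bm[of a] Bm[of b] ab by (intro measurable_sets[of _ _ borel]) auto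
  have T_eq: "(\<lambda>\<omega>. restrict (\<lambda>i. X i \<omega>) {n}) -` T \<inter> space M = ?D"
    by (auto simp: T_def X_def \<tau>b \<tau>n space_PiM PiE_def)
  \<comment> \<open>Only almost surely, because \<open>B 0\<close> vanishes only almost
    surely.\<close>
  have AEC: "AE \<omega> in M. \<omega> \<in> ?C \<longleftrightarrow> \<omega> \<in> ?C'"
  proof -
    have "AE \<omega> in M. B 0 \<omega> = 0" using BM by (simp add: brownian_motion_def)
    then show ?thesis
    proof (eventually_elim)
      fix \<omega> assume z: "B 0 \<omega> = 0"
      have s: "(\<Sum>i<k. restrict (\<lambda>i. X i \<omega>) {..<n} i) = B (\<tau> k) \<omega>" if "k \<le> n" for k
        using that tel[of \<omega> k] z by (subst sum.cong[OF refl, of _ _ "\<lambda>i. X i \<omega>"]) auto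
      have "\<omega> \<in> ?C' \<longleftrightarrow> \<omega> \<in> space M \<and> (\<forall>k\<in>{..n}. (\<Sum>i<k. restrict (\<lambda>i. X i \<omega>) {..<n} i) \<in> A' k)"
        by (auto simp: S_def space_PiM PiE_def simp del: restrict_apply)
      also have "\<dots> \<longleftrightarrow> \<omega> \<in> space M \<and> (\<forall>k\<in>{..n}. B (\<tau> k) \<omega> \<in> A' k)"
        by (intro conj_cong ball_cong refl) (simp only: s atMost_iff)
      finally have C': "\<omega> \<in> ?C' \<longleftrightarrow> \<omega> \<in> space M \<and> (\<forall>k\<in>{..n}. B (\<tau> k) \<omega> \<in> A' k)" .
      have "(\<forall>s\<in>J. B s \<omega> \<in> A s) \<longleftrightarrow> (\<forall>k\<in>{..n}. B (\<tau> k) \<omega> \<in> A' k)"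
      proof -
        have "\<exists>k\<le>n. s = \<tau> k" if "s \<in> J" for s
          using that setL \<tau>L lenL by (metis in_set_conv_nth insertI2 less_Suc_eq_le)
        then show ?thesis by (auto simp: A'_def split: if_splits)
      qed
      then show "\<omega> \<in> ?C \<longleftrightarrow> \<omega> \<in> ?C'" unfolding C' by simp
    qed
  qed
  have e1: "measure M ?C = measure M ?C'"
    using AEC Cm C'm by (intro finite_measure_eq_AE)
  have e2: "measure M (?C \<inter> ?D) = measure M (?C' \<inter> ?D)"
  proof (rule finite_measure_eq_AE)
    show "AE x in M. (x \<in> ?C \<inter> ?D) = (x \<in> ?C' \<inter> ?D)" using AEC by eventually_elim blast
  qed (use Cm C'm Dm in auto)
  have "measure M (?C' \<inter> ?D) = measure M ?C' * measure M ?D"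
    using indep_varD[OF iv Sm Tm] unfolding T_eq[symmetric]
    by (simp add: vimage_Times[symmetric] vimage_def Int_def conj_ac)
  then show ?thesis using e1 e2 by simp
qed

text \<open>Independence of the increment from the augmented filtration at time \<open>a\<close>, in
  the form in which Fubini can freeze everything known at \<open>a\<close>. It follows from the
  cylinder case because cylinders and null sets together form an intersection-stable generator. The
  identity map into \<open>F\<close> stands for the restriction of \<open>M\<close> to the smaller
  sigma-algebra.\<close>

lemma brownian_increment_joint_law:
  assumes BM: "brownian_motion M B" and ab: "0 \<le> a" "a < b"
  defines "Y \<equiv> \<lambda>\<omega>. B b \<omega> - B a \<omega>" and "F \<equiv> brownian_filtration M B a"
  shows "distr M F (\<lambda>\<omega>. \<omega>) \<Otimes>\<^sub>M distr M borel Y = distr M (F \<Otimes>\<^sub>M borel) (\<lambda>\<omega>. (\<omega>, Y \<omega>))"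
proof -
  interpret prob_space M using BM by (simp add: brownian_motion_def)
  have Bm[measurable]: "B t \<in> borel_measurable M" if "t \<ge> 0" for t
    using BM that by (simp add: brownian_motion_def)
  have incm: "(\<lambda>\<omega>. B b \<omega> - B a \<omega>) \<in> borel_measurable M" using ab by simp
  let ?G = "{B s -` A \<inter> space M | s A. 0 \<le> s \<and> s \<le> a \<and> A \<in> sets borel} \<union> null_sets M"
  let ?Y = "{(\<lambda>\<omega>. B b \<omega> - B a \<omega>) -` A \<inter> space M | A. A \<in> sets borel}"
  define cyl where "cyl J A = {\<omega>\<in>space M. \<forall>s\<in>J. B s \<omega> \<in> A s}" for J A
  \<comment> \<open>The augmentation is absorbed here: null sets are independent of every event, and
    meeting one with an event leaves a null set, so stability under intersection survives.\<close>
  define Cy where "Cy = {cyl J A | J A. finite J \<and> J \<subseteq> {0..a} \<and> (\<forall>s\<in>J. A s \<in> sets borel)} \<union> null_sets M"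
  have cylm: "cyl J A \<in> events" if "finite J" "J \<subseteq> {0..a}" "\<forall>s\<in>J. A s \<in> sets borel" for J A
    unfolding cyl_def
  proof (intro sets.sets_Collect_finite_All)
    fix s assume "s \<in> J"
    then show "{\<omega>\<in>space M. B s \<omega> \<in> A s} \<in> events"
      using that Bm[of s] by (auto simp: measurable_def vimage_def Int_def conj_commute)
  qed (use that in auto)
  have Ym: "?Y \<subseteq> events" using incm by (auto intro: measurable_sets)
  have "indep_set Cy ?Y"
  proof (rule indep_setI)
    show "Cy \<subseteq> events" using cylm by (auto simp: Cy_def)
    fix C D assume C: "C \<in> Cy" and D: "D \<in> ?Y"
    then obtain A0 where A0: "A0 \<in> sets borel" "D = (\<lambda>\<omega>. B b \<omega> - B a \<omega>) -` A0 \<inter> space M" by auto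
    show "prob (C \<inter> D) = prob C * prob D"
    proof (cases "C \<in> null_sets M")
      case True
      then have "C \<inter> D \<in> null_sets M" using D Ym by (intro null_set_Int2) auto
      then show ?thesis using True by (simp add: measure_eq_0_null_sets)
    next
      case False
      then obtain J A where "C = cyl J A" "finite J" "J \<subseteq> {0..a}" "\<forall>s\<in>J. A s \<in> sets borel"
        using C by (auto simp: Cy_def)
      then show ?thesis using brownian_cylinder_indep[OF BM ab, of J A A0] A0 by (simp add: cyl_def)
    qed
  qed (fact Ym)
  moreover have "Int_stable Cy"
  proof (rule Int_stableI)
    fix C D assume CD: "C \<in> Cy" "D \<in> Cy"
    have ev: "Cy \<subseteq> events" using cylm by (auto simp: Cy_def)
    show "C \<inter> D \<in> Cy"
    proof (cases "C \<in> null_sets M \<or> D \<in> null_sets M")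
      case True
      then have "C \<inter> D \<in> null_sets M" using CD ev by (metis in_mono null_set_Int1 null_set_Int2)
      then show ?thesis by (simp add: Cy_def)
    next
      case False
      then obtain J A J' A' where *: "C = cyl J A" "finite J" "J \<subseteq> {0..a}" "\<forall>s\<in>J. A s \<in> sets borel"
        "D = cyl J' A'" "finite J'" "J' \<subseteq> {0..a}" "\<forall>s\<in>J'. A' s \<in> sets borel"
        using CD by (auto simp: Cy_def)
      define A'' where "A'' s = (if s \<in> J then A s else UNIV) \<inter> (if s \<in> J' then A' s else UNIV)" for s
      have "C \<inter> D = cyl (J \<union> J') A''" by (auto simp: * cyl_def A''_def)
      moreover have "\<forall>s\<in>J \<union> J'. A'' s \<in> sets borel" using * by (auto simp: A''_def)
      ultimately show ?thesis using * unfolding Cy_def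
        by (intro UnI1 CollectI exI[of _ "J \<union> J'"] exI[of _ A'']) auto
    qed
  qed
  moreover have "Int_stable ?Y"
  proof (rule Int_stableI)
    fix C D assume "C \<in> ?Y" "D \<in> ?Y"
    then obtain A A' where "A \<in> sets borel" "A' \<in> sets borel"
       "C = (\<lambda>\<omega>. B b \<omega> - B a \<omega>) -` A \<inter> space M" "D = (\<lambda>\<omega>. B b \<omega> - B a \<omega>) -` A' \<inter> space M" by auto
    then show "C \<inter> D \<in> ?Y" by (intro CollectI exI[of _ "A \<inter> A'"]) auto
  qed
  ultimately have ind: "indep_set (sigma_sets (space M) Cy) (sigma_sets (space M) ?Y)"
    by (rule indep_set_sigma_sets)
  have setsF: "sets (brownian_filtration M B a) = sigma_sets (space M) ?G"
    unfolding brownian_filtration_def by (rule sets_measure_of) (auto dest!: null_setsD2 sets.sets_into_space)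
  have GCy: "?G \<subseteq> Cy"
  proof
    fix C assume "C \<in> ?G"
    then consider "C \<in> null_sets M" | s A where "0 \<le> s" "s \<le> a" "A \<in> sets borel" "C = B s -` A \<inter> space M" by auto
    then show "C \<in> Cy"
    proof cases
      case 2
      then have "C = cyl {s} (\<lambda>_. A)" by (auto simp: cyl_def)
      then show ?thesis using 2 unfolding Cy_def
        by (intro UnI1 CollectI exI[of _ "{s}"] exI[of _ "\<lambda>_. A"]) auto
    qed (simp add: Cy_def)
  qed
  have idm[measurable]: "(\<lambda>\<omega>. \<omega>) \<in> measurable M F"
    unfolding F_def using sets_brownian_filtration_subset[OF BM]
    by (intro measurableI) (auto intro: sets.Int sets.top)
  have Ym[measurable]: "Y \<in> borel_measurable M" using incm by (simp add: Y_def)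
  interpret D1: prob_space "distr M F (\<lambda>\<omega>. \<omega>)" using idm by (rule prob_space_distr)
  interpret D2: prob_space "distr M borel Y" using Ym by (rule prob_space_distr)
  show ?thesis
  proof (rule pair_measure_eqI)
    fix A1 A2 assume A: "A1 \<in> sets (distr M F (\<lambda>\<omega>. \<omega>))" "A2 \<in> sets (distr M borel Y)"
    have A1: "A1 \<in> sigma_sets (space M) Cy"
      using A(1) setsF sigma_sets_mono'[OF GCy, of "space M"] by (auto simp: F_def)
    have A1': "A1 \<inter> space M = A1" using A(1) sets.sets_into_space[of A1 F] by (auto simp: F_def)
    have A2: "Y -` A2 \<inter> space M \<in> sigma_sets (space M) ?Y"
      using A(2) unfolding Y_def by (intro sigma_sets.Basic) auto
    have "prob (A1 \<inter> (Y -` A2 \<inter> space M)) = prob A1 * prob (Y -` A2 \<inter> space M)"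
      by (rule indep_setD[OF ind A1 A2])
    moreover have "(\<lambda>\<omega>. (\<omega>, Y \<omega>)) -` (A1 \<times> A2) \<inter> space M = A1 \<inter> (Y -` A2 \<inter> space M)"
      using A1' by auto
    ultimately show "emeasure (distr M F (\<lambda>\<omega>. \<omega>)) A1 * emeasure (distr M borel Y) A2 =
        emeasure (distr M (F \<Otimes>\<^sub>M borel) (\<lambda>\<omega>. (\<omega>, Y \<omega>))) (A1 \<times> A2)"
      using A A1' by (simp add: emeasure_distr emeasure_eq_measure ennreal_mult)
  qed (simp_all add: D1.sigma_finite_measure_axioms D2.sigma_finite_measure_axioms cong: sets_pair_measure_cong)
qed

subsection \<open>Exponentials of simple integrals\<close>

text \<open>Completing the square: the exponential factor turns the centred normal density into the
  one with mean \<open>c * \<sigma>\<^sup>2\<close> and the same variance, which has total mass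
  1.\<close>

lemma nn_integral_gaussian_exp_martingale:
  fixes c \<sigma> :: real
  assumes "\<sigma> > 0"
  shows "(\<integral>\<^sup>+ y. ennreal (exp (c * y - c\<^sup>2 * \<sigma>\<^sup>2 / 2)) \<partial>density lborel (\<lambda>y. ennreal (normal_density 0 \<sigma> y))) = 1"
proof -
  have eq: "normal_density 0 \<sigma> y * exp (c * y - c\<^sup>2 * \<sigma>\<^sup>2 / 2) = normal_density (c * \<sigma>\<^sup>2) \<sigma> y" for y
  proof -
    have "- y\<^sup>2 / (2 * \<sigma>\<^sup>2) + (c * y - c\<^sup>2 * \<sigma>\<^sup>2 / 2) = - (y - c * \<sigma>\<^sup>2)\<^sup>2 / (2 * \<sigma>\<^sup>2)"
      using assms by (simp add: field_simps power2_eq_square)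
    then show ?thesis by (simp add: normal_density_def mult.assoc exp_add[symmetric])
  qed
  interpret N: prob_space "density lborel (\<lambda>y. ennreal (normal_density (c * \<sigma>\<^sup>2) \<sigma> y))"
    using assms by (rule prob_space_normal_density)
  have "(\<integral>\<^sup>+ y. ennreal (exp (c * y - c\<^sup>2 * \<sigma>\<^sup>2 / 2)) \<partial>density lborel (\<lambda>y. ennreal (normal_density 0 \<sigma> y)))
     = (\<integral>\<^sup>+ y. ennreal (normal_density (c * \<sigma>\<^sup>2) \<sigma> y) \<partial>lborel)"
    by (subst nn_integral_density) (auto simp: ennreal_mult'[symmetric] eq)
  also have "\<dots> = emeasure (density lborel (\<lambda>y. ennreal (normal_density (c * \<sigma>\<^sup>2) \<sigma> y))) UNIV"
    by (simp add: emeasure_density)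
  also have "\<dots> = 1" using N.emeasure_space_1 by simp
  finally show ?thesis .
qed

text \<open>With \<omega> frozen, \<open>W\<close> and \<xi> are constants with respect to the
  independent increment, whose Gaussian exponential integrates to 1. This is the conditional
  expectation step, written with a nonnegative weight \<open>W\<close> so that no integrability
  arises.\<close>

lemma brownian_exp_increment:
  assumes BM: "brownian_motion M B" and ab: "0 \<le> a" "a \<le> b"
    and W: "W \<in> borel_measurable (brownian_filtration M B a)"
    and \<xi>: "\<xi> \<in> borel_measurable (brownian_filtration M B a)"
  shows "(\<integral>\<^sup>+ \<omega>. W \<omega> * ennreal (exp (\<xi> \<omega> * (B b \<omega> - B a \<omega>) - (\<xi> \<omega>)\<^sup>2 * (b - a) / 2)) \<partial>M) = (\<integral>\<^sup>+ \<omega>. W \<omega> \<partial>M)"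
proof (cases "a = b")
  case False
  with ab have "a < b" by simp
  interpret prob_space M using BM by (simp add: brownian_motion_def)
  let ?F = "brownian_filtration M B a" and ?Y = "\<lambda>\<omega>. B b \<omega> - B a \<omega>"
  let ?h = "\<lambda>(\<omega>, y). W \<omega> * ennreal (exp (\<xi> \<omega> * y - (\<xi> \<omega>)\<^sup>2 * (b - a) / 2))"
  have rv[measurable]: "(\<lambda>\<omega>. \<omega>) \<in> measurable M ?F" "?Y \<in> borel_measurable M"
    using measurable_brownian_filtration_imp[OF BM measurable_ident_sets[OF refl], of a] BM ab
    by (auto simp: brownian_motion_def intro!: borel_measurable_diff)
  have joint: "distr M ?F (\<lambda>\<omega>. \<omega>) \<Otimes>\<^sub>M distr M borel ?Y = distr M (?F \<Otimes>\<^sub>M borel) (\<lambda>\<omega>. (\<omega>, ?Y \<omega>))"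
    by (rule brownian_increment_joint_law[OF BM ab(1) \<open>a < b\<close>])
  have "distributed M lborel ?Y (normal_density 0 (sqrt (b - a)))"
    using BM ab \<open>a < b\<close> by (simp add: brownian_motion_def)
  then have dY: "distr M borel ?Y = density lborel (\<lambda>y. ennreal (normal_density 0 (sqrt (b - a)) y))"
    by (subst distributed_distr_eq_density[symmetric]) (auto intro: distr_cong)
  note W[measurable] \<xi>[measurable]
  have hm[measurable]: "?h \<in> borel_measurable (?F \<Otimes>\<^sub>M borel)" by measurable
  interpret DY: prob_space "distr M borel ?Y" using rv(2) by (rule prob_space_distr)
  have Wm: "W \<in> borel_measurable M" by (rule measurable_brownian_filtration_imp[OF BM W])
  have "(\<integral>\<^sup>+ \<omega>. ?h (\<omega>, ?Y \<omega>) \<partial>M) = (\<integral>\<^sup>+ z. ?h z \<partial>distr M (?F \<Otimes>\<^sub>M borel) (\<lambda>\<omega>. (\<omega>, ?Y \<omega>)))"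
    by (subst nn_integral_distr) auto
  also have "\<dots> = (\<integral>\<^sup>+ \<omega>. \<integral>\<^sup>+ y. ?h (\<omega>, y) \<partial>distr M borel ?Y \<partial>distr M ?F (\<lambda>\<omega>. \<omega>))"
    unfolding joint[symmetric] by (rule DY.nn_integral_fst[symmetric]) simp
  also have "\<dots> = (\<integral>\<^sup>+ \<omega>. W \<omega> \<partial>distr M ?F (\<lambda>\<omega>. \<omega>))"
  proof (rule nn_integral_cong)
    fix \<omega>
    have "(\<integral>\<^sup>+ y. ?h (\<omega>, y) \<partial>distr M borel ?Y) =
        W \<omega> * (\<integral>\<^sup>+ y. ennreal (exp (\<xi> \<omega> * y - (\<xi> \<omega>)\<^sup>2 * (sqrt (b - a))\<^sup>2 / 2)) \<partial>distr M borel ?Y)"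
      using \<open>a < b\<close> by (simp add: nn_integral_cmult)
    then show "(\<integral>\<^sup>+ y. ?h (\<omega>, y) \<partial>distr M borel ?Y) = W \<omega>"
      unfolding dY using \<open>a < b\<close> by (subst (asm) nn_integral_gaussian_exp_martingale) auto
  qed
  also have "\<dots> = (\<integral>\<^sup>+ \<omega>. W \<omega> \<partial>M)" by (subst nn_integral_distr) auto
  finally show ?thesis by simp
qed simp

text \<open>For \<open>s \<le> t\<close> this is the projection of \<open>x\<close> to [s, t].
  Clipping the endpoints of all pieces restricts a simple process to a time window while keeping its
  index set; pieces outside the window become degenerate.\<close>

definition clip :: "real \<Rightarrow> real \<Rightarrow> real \<Rightarrow> real" where
  "clip s t x = max s (min t x)"

text \<open>Finite-sum form of the integral of the squared simple process over (s, t];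
  \<open>simple_value_energy\<close> proves that it is this integral.\<close>

definition simple_energy :: "nat \<Rightarrow> (nat \<Rightarrow> real) \<Rightarrow> (nat \<Rightarrow> 'a \<Rightarrow> real) \<Rightarrow> real \<Rightarrow> real \<Rightarrow> 'a \<Rightarrow> real" where
  "simple_energy n \<tau> \<xi> s t \<omega> = (\<Sum>i<n. (\<xi> i \<omega>)\<^sup>2 * (clip s t (\<tau> (Suc i)) - clip s t (\<tau> i)))"

lemma clip_mono: "x \<le> y \<Longrightarrow> clip s t x \<le> clip s t y"
  by (auto simp: clip_def)

lemma simple_process_mono:
  assumes "simple_process F n \<tau> \<xi>" "i \<le> j" "j \<le> n"
  shows "\<tau> i \<le> \<tau> j"
  using assms(2,3)
proof (induction j rule: dec_induct)
  case (step j)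
  then have "\<tau> j < \<tau> (Suc j)" using assms(1) by (auto simp: simple_process_def)
  then show ?case using step by simp
qed simp

text \<open>Stopping at \<open>t\<close> minus stopping at \<open>s\<close> equals \<open>B\<close>
  at the clipped time minus \<open>B s\<close>, and the terms \<open>B s\<close> cancel between the
  two ends of a piece.\<close>

lemma simple_integral_diff:
  assumes "simple_process F n \<tau> \<xi>" "s \<le> t"
  shows "simple_integral B n \<tau> \<xi> t \<omega> - simple_integral B n \<tau> \<xi> s \<omega> =
    (\<Sum>i<n. \<xi> i \<omega> * (B (clip s t (\<tau> (Suc i))) \<omega> - B (clip s t (\<tau> i)) \<omega>))"
proof -
  have "B (min t x) \<omega> - B (min s x) \<omega> = B (clip s t x) \<omega> - B s \<omega>" for x
    using assms(2) by (cases "x \<le> s") (auto simp: clip_def min_def max_def)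
  then have *: "(B (min t x) \<omega> - B (min t y) \<omega>) - (B (min s x) \<omega> - B (min s y) \<omega>) =
      B (clip s t x) \<omega> - B (clip s t y) \<omega>" for x y
    by (smt (verit))
  show ?thesis
    unfolding simple_integral_def sum_subtractf[symmetric] right_diff_distrib[symmetric] * ..
qed

text \<open>Induction over the pieces of the simple process inside the window: the weight together
  with the factors of the first \<open>m\<close> pieces is known at the clipped time of
  \<open>\<tau> m\<close> and serves as the weight for the next piece.\<close>

lemma simple_exp_step:
  assumes BM: "brownian_motion M B" and F: "F = brownian_filtration M B"
    and sp: "simple_process F n \<tau> \<xi>" and st: "0 \<le> s" "s \<le> t"
    and W: "W \<in> borel_measurable (F s)"
  shows "(\<integral>\<^sup>+ \<omega>. W \<omega> * ennreal (exp (c * (simple_integral B n \<tau> \<xi> t \<omega> - simple_integral B n \<tau> \<xi> s \<omega>)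
              - c\<^sup>2 / 2 * simple_energy n \<tau> \<xi> s t \<omega>)) \<partial>M) = (\<integral>\<^sup>+ \<omega>. W \<omega> \<partial>M)" (is ?int)
    and "(\<lambda>\<omega>. W \<omega> * ennreal (exp (c * (simple_integral B n \<tau> \<xi> t \<omega> - simple_integral B n \<tau> \<xi> s \<omega>)
              - c\<^sup>2 / 2 * simple_energy n \<tau> \<xi> s t \<omega>))) \<in> borel_measurable (F t)" (is ?meas)
proof -
  define cl where "cl = clip s t"
  have cl: "s \<le> cl x" "cl x \<le> t" for x using st by (auto simp: cl_def clip_def)
  define E where "E i \<omega> = (c * \<xi> i \<omega>) * (B (cl (\<tau> (Suc i))) \<omega> - B (cl (\<tau> i)) \<omega>)
      - (c * \<xi> i \<omega>)\<^sup>2 * (cl (\<tau> (Suc i)) - cl (\<tau> i)) / 2" for i \<omega>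
  have *: "(\<integral>\<^sup>+ \<omega>. W \<omega> * ennreal (exp (\<Sum>i<m. E i \<omega>)) \<partial>M) = (\<integral>\<^sup>+ \<omega>. W \<omega> \<partial>M) \<and>
      (\<lambda>\<omega>. W \<omega> * ennreal (exp (\<Sum>i<m. E i \<omega>))) \<in> borel_measurable (F (cl (\<tau> m)))" if "m \<le> n" for m
    using that
  proof (induction m)
    case 0
    then show ?case using W measurable_brownian_filtration_mono[OF BM cl(1)] by (simp add: F)
  next
    case (Suc m)
    let ?a = "cl (\<tau> m)" and ?b = "cl (\<tau> (Suc m))"
    let ?W = "\<lambda>\<omega>. W \<omega> * ennreal (exp (\<Sum>i<m. E i \<omega>))"
    have \<tau>m: "\<tau> m < \<tau> (Suc m)" using sp Suc.prems by (auto simp: simple_process_def)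
    have ab: "?a \<le> ?b" using \<tau>m by (auto simp: cl_def intro: clip_mono)
    have IH: "(\<integral>\<^sup>+ \<omega>. ?W \<omega> \<partial>M) = (\<integral>\<^sup>+ \<omega>. W \<omega> \<partial>M)" "?W \<in> borel_measurable (F ?a)"
      using Suc by auto
    have split: "W \<omega> * ennreal (exp (\<Sum>i<Suc m. E i \<omega>)) = ?W \<omega> * ennreal (exp (E m \<omega>))" for \<omega>
      by (simp add: exp_add ennreal_mult mult.assoc)
    show ?case
    \<comment> \<open>A degenerate piece contributes the factor 1. It must be split off because a
      piece starting after \<open>t\<close> has a value \<open>\<xi> m\<close> that need not be
      known at \<open>?a\<close>; a nondegenerate piece has
      \<open>\<tau> m \<le> ?a\<close>.\<close>
    proof (cases "?a = ?b")
      case True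
      then show ?thesis using IH unfolding split by (simp add: E_def)
    next
      case False
      then have "\<tau> m \<le> ?a" using \<tau>m st by (auto simp: cl_def clip_def min_def max_def split: if_splits)
      moreover have "\<xi> m \<in> borel_measurable (F (\<tau> m))"
        using sp Suc.prems by (auto simp: simple_process_def)
      ultimately have \<xi>a: "\<xi> m \<in> borel_measurable (F ?a)"
        using measurable_brownian_filtration_mono[OF BM] by (simp add: F)
      have "(\<integral>\<^sup>+ \<omega>. ?W \<omega> * ennreal (exp (E m \<omega>)) \<partial>M) = (\<integral>\<^sup>+ \<omega>. ?W \<omega> \<partial>M)"
        unfolding E_def[of m]
        by (rule brownian_exp_increment[OF BM _ ab]) (use IH(2) \<xi>a cl(1)[of "\<tau> m"] st in \<open>auto simp: F\<close>)
      moreover have "(\<lambda>\<omega>. ?W \<omega> * ennreal (exp (E m \<omega>))) \<in> borel_measurable (F ?b)"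
      proof -
        have a0: "0 \<le> ?a" using cl(1)[of "\<tau> m"] st by simp
        have Wb: "?W \<in> borel_measurable (F ?b)" and [measurable]: "\<xi> m \<in> borel_measurable (F ?b)"
          using measurable_brownian_filtration_mono[OF BM ab] IH(2) \<xi>a by (simp_all add: F)
        have [measurable]: "B ?a \<in> borel_measurable (F ?b)" "B ?b \<in> borel_measurable (F ?b)"
          unfolding F using brownian_motion_measurable_filtration[OF a0 ab]
            brownian_motion_measurable_filtration[OF order_trans[OF a0 ab] order_refl] by auto
        have "(\<lambda>\<omega>. ennreal (exp (E m \<omega>))) \<in> borel_measurable (F ?b)"
          unfolding E_def[of m] by measurable
        from borel_measurable_times_ennreal[OF Wb this] show ?thesis .
      qed
      ultimately show ?thesis unfolding split using IH(1) by simp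
    qed
  qed
  have sum: "(\<Sum>i<n. E i \<omega>) = c * (simple_integral B n \<tau> \<xi> t \<omega> - simple_integral B n \<tau> \<xi> s \<omega>)
              - c\<^sup>2 / 2 * simple_energy n \<tau> \<xi> s t \<omega>" for \<omega>
    unfolding simple_integral_diff[OF sp st(2)] simple_energy_def sum_distrib_left sum_subtractf[symmetric]
    by (intro sum.cong refl) (simp add: E_def cl_def power_mult_distrib field_simps)
  show ?int using *[of n] by (simp add: sum)
  have "(\<lambda>\<omega>. W \<omega> * ennreal (exp (\<Sum>i<n. E i \<omega>))) \<in> borel_measurable (F t)"
    using *[of n] measurable_brownian_filtration_mono[OF BM cl(2)[of "\<tau> n"]] unfolding F by blast
  then show ?meas unfolding sum .
qed

text \<open>The deterministic step function \<open>c\<close> may change from window to window: the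
  exponential over the earlier windows is the weight in \<open>simple_exp_step\<close> for the next
  one.\<close>

lemma simple_exp_martingale:
  fixes c t :: "nat \<Rightarrow> real"
  assumes BM: "brownian_motion M B" and F: "F = brownian_filtration M B"
    and sp: "simple_process F n \<tau> \<xi>" and t0: "0 \<le> t 0" and tm: "\<And>j. t j \<le> t (Suc j)"
  defines "D j \<omega> \<equiv> c j * (simple_integral B n \<tau> \<xi> (t (Suc j)) \<omega> - simple_integral B n \<tau> \<xi> (t j) \<omega>)
              - (c j)\<^sup>2 / 2 * simple_energy n \<tau> \<xi> (t j) (t (Suc j)) \<omega>"
  shows "(\<integral>\<^sup>+ \<omega>. ennreal (exp (\<Sum>j<N. D j \<omega>)) \<partial>M) = 1" (is ?int)
    and "(\<lambda>\<omega>. ennreal (exp (\<Sum>j<N. D j \<omega>))) \<in> borel_measurable M" (is ?meas)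
proof -
  interpret prob_space M using BM by (simp add: brownian_motion_def)
  have tN: "0 \<le> t j" for j using lift_Suc_mono_le[of t 0 j, OF tm] t0 by simp
  have "(\<integral>\<^sup>+ \<omega>. ennreal (exp (\<Sum>j<N. D j \<omega>)) \<partial>M) = 1 \<and>
    (\<lambda>\<omega>. ennreal (exp (\<Sum>j<N. D j \<omega>))) \<in> borel_measurable (F (t N))"
  proof (induction N)
    case 0
    then show ?case by (simp add: emeasure_space_1)
  next
    case (Suc N)
    have split: "ennreal (exp (\<Sum>j<Suc N. D j \<omega>)) = ennreal (exp (\<Sum>j<N. D j \<omega>)) * ennreal (exp (D N \<omega>))" for \<omega>
      by (simp add: exp_add ennreal_mult)
    show ?case
      unfolding split unfolding D_def[of N]
      using simple_exp_step[OF BM F sp tN[of N] tm[of N] conjunct2[OF Suc], of "c N"] Suc by simp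
  qed
  then show ?int ?meas using measurable_brownian_filtration_imp[OF BM] by (auto simp: F)
qed

text \<open>The pieces of a simple process are disjoint, so squaring the sum produces no cross
  terms.\<close>

lemma simple_value_energy:
  assumes sp: "simple_process F n \<tau> \<xi>" and st: "s \<le> t"
  shows "(\<integral>\<^sup>+ r\<in>{s<..t}. ennreal ((simple_value n \<tau> \<xi> r \<omega>)\<^sup>2) \<partial>lborel) = ennreal (simple_energy n \<tau> \<xi> s t \<omega>)"
proof -
  define A where "A i = {\<tau> i<..\<tau> (Suc i)}" for i
  have dis: "i = j" if "r \<in> A i" "r \<in> A j" "i < n" "j < n" for i j r
    using that simple_process_mono[OF sp, of "Suc i" j] simple_process_mono[OF sp, of "Suc j" i]
    by (cases i j rule: linorder_cases) (auto simp: A_def)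
  have sq: "(simple_value n \<tau> \<xi> r \<omega>)\<^sup>2 = (\<Sum>i<n. (\<xi> i \<omega>)\<^sup>2 * indicator (A i) r)" for r
  proof (cases "\<exists>k<n. r \<in> A k")
    case True
    then obtain k where k: "k < n" "r \<in> A k" by auto
    have "(\<Sum>i<n. f i * indicator (A i) r) = f k" for f :: "nat \<Rightarrow> real"
      using k dis by (subst sum.mono_neutral_right[of _ "{k}"]) (auto simp: indicator_def)
    then show ?thesis unfolding simple_value_def A_def[symmetric] by simp
  next
    case False
    then show ?thesis unfolding simple_value_def A_def[symmetric]
      by (auto simp: indicator_def intro!: sum.neutral)
  qed
  have cl: "clip s t (\<tau> i) \<le> clip s t (\<tau> (Suc i))" if "i < n" for i
    using sp that by (intro clip_mono less_imp_le) (auto simp: simple_process_def)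
  have ind: "indicator (A i) r * indicator {s<..t} r = (indicator {clip s t (\<tau> i)<..clip s t (\<tau> (Suc i))} r :: real)" for i r
    by (auto simp: A_def clip_def indicator_def)
  have "ennreal ((simple_value n \<tau> \<xi> r \<omega>)\<^sup>2) * indicator {s<..t} r =
      (\<Sum>i<n. ennreal ((\<xi> i \<omega>)\<^sup>2) * indicator {clip s t (\<tau> i)<..clip s t (\<tau> (Suc i))} r)" for r
  proof -
    have "ennreal ((simple_value n \<tau> \<xi> r \<omega>)\<^sup>2) * indicator {s<..t} r =
       ennreal (\<Sum>i<n. (\<xi> i \<omega>)\<^sup>2 * indicator {clip s t (\<tau> i)<..clip s t (\<tau> (Suc i))} r)"
    proof -
      have "(simple_value n \<tau> \<xi> r \<omega>)\<^sup>2 * indicator {s<..t} r =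
         (\<Sum>i<n. (\<xi> i \<omega>)\<^sup>2 * indicator {clip s t (\<tau> i)<..clip s t (\<tau> (Suc i))} r)"
        unfolding sq sum_distrib_right by (simp only: mult.assoc ind)
      then show ?thesis by (simp only: ennreal_indicator[symmetric] ennreal_mult'[symmetric] zero_le_power2)
    qed
    also have "\<dots> = (\<Sum>i<n. ennreal ((\<xi> i \<omega>)\<^sup>2 * indicator {clip s t (\<tau> i)<..clip s t (\<tau> (Suc i))} r))"
      by (rule sum_ennreal[symmetric]) simp
    finally show ?thesis by (simp add: ennreal_mult ennreal_indicator)
  qed
  note eq = this
  have "(\<integral>\<^sup>+ r\<in>{s<..t}. ennreal ((simple_value n \<tau> \<xi> r \<omega>)\<^sup>2) \<partial>lborel) =
     (\<Sum>i<n. \<integral>\<^sup>+ r. ennreal ((\<xi> i \<omega>)\<^sup>2) * indicator {clip s t (\<tau> i)<..clip s t (\<tau> (Suc i))} r \<partial>lborel)"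
    unfolding eq by (rule nn_integral_sum) simp
  also have "\<dots> = (\<Sum>i<n. ennreal ((\<xi> i \<omega>)\<^sup>2 * (clip s t (\<tau> (Suc i)) - clip s t (\<tau> i))))"
    using cl by (intro sum.cong refl) (auto simp: nn_integral_cmult_indicator ennreal_mult)
  also have "\<dots> = ennreal (simple_energy n \<tau> \<xi> s t \<omega>)"
    unfolding simple_energy_def using cl by (intro sum_ennreal) auto
  finally show ?thesis .
qed

subsection \<open>Passage to the limit in probability\<close>

text \<open>A form of Fatou's lemma for limits in probability, avoiding subsequences. Cut at height
  \<open>m\<close>, the exponential costs at most \<open>m\<close> times the probability of the
  exceptional set. The limits are taken in the order \<open>k\<close> to infinity, \<epsilon> to 0,
  \<open>m\<close> to infinity.\<close>

lemma (in prob_space) nn_integral_exp_le_1_limit_in_probability: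
  fixes X :: "'a \<Rightarrow> real" and Y :: "nat \<Rightarrow> 'a \<Rightarrow> real"
  assumes X[measurable]: "X \<in> borel_measurable M"
    and Y[measurable]: "\<And>k. (\<lambda>\<omega>. ennreal (exp (Y k \<omega>))) \<in> borel_measurable M"
    and le1: "\<And>k. (\<integral>\<^sup>+ \<omega>. ennreal (exp (Y k \<omega>)) \<partial>M) \<le> 1"
    and bad: "\<And>\<epsilon>. \<epsilon> > 0 \<Longrightarrow> \<exists>A. (\<forall>k. A k \<in> sets M) \<and> (\<lambda>k. measure M (A k)) \<longlonglongrightarrow> 0 \<and>
        (\<forall>k. \<forall>\<omega>\<in>space M - A k. X \<omega> \<le> Y k \<omega> + \<epsilon>)"
  shows "(\<integral>\<^sup>+ \<omega>. ennreal (exp (X \<omega>)) \<partial>M) \<le> 1"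
proof -
  have trunc: "(\<integral>\<^sup>+ \<omega>. ennreal (min (real m) (exp (X \<omega>))) \<partial>M) \<le> ennreal (exp \<epsilon>)" if eps: "\<epsilon> > 0" for m \<epsilon>
  proof -
    obtain A where A[measurable]: "\<And>k. A k \<in> sets M" and lim: "(\<lambda>k. measure M (A k)) \<longlonglongrightarrow> 0"
      and le: "\<And>k \<omega>. \<omega> \<in> space M - A k \<Longrightarrow> X \<omega> \<le> Y k \<omega> + \<epsilon>"
      using bad[OF eps] by blast
    have "(\<integral>\<^sup>+ \<omega>. ennreal (min (real m) (exp (X \<omega>))) \<partial>M) \<le> ennreal (exp \<epsilon> + real m * measure M (A k))" for k
    proof -
      have "(\<integral>\<^sup>+ \<omega>. ennreal (min (real m) (exp (X \<omega>))) \<partial>M)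
         \<le> (\<integral>\<^sup>+ \<omega>. ennreal (exp \<epsilon>) * ennreal (exp (Y k \<omega>)) + ennreal (real m) * indicator (A k) \<omega> \<partial>M)"
      proof (rule nn_integral_mono)
        fix \<omega> assume w: "\<omega> \<in> space M"
        show "ennreal (min (real m) (exp (X \<omega>))) \<le>
            ennreal (exp \<epsilon>) * ennreal (exp (Y k \<omega>)) + ennreal (real m) * indicator (A k) \<omega>"
        proof (cases "\<omega> \<in> A k")
          case True
          have "ennreal (min (real m) (exp (X \<omega>))) \<le> ennreal (real m)" by (rule ennreal_leI) simp
          then show ?thesis using True by (simp add: add_increasing)
        next
          case False
          then have "exp (X \<omega>) \<le> exp \<epsilon> * exp (Y k \<omega>)"
            using le[of \<omega> k] w by (simp add: exp_add[symmetric] add.commute)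
          then have "min (real m) (exp (X \<omega>)) \<le> exp \<epsilon> * exp (Y k \<omega>)" by linarith
          then show ?thesis using False by (simp add: ennreal_mult'[symmetric] ennreal_leI)
        qed
      qed
      also have "\<dots> = ennreal (exp \<epsilon>) * (\<integral>\<^sup>+ \<omega>. ennreal (exp (Y k \<omega>)) \<partial>M) + ennreal (real m) * emeasure M (A k)"
        using Y A
        by (subst nn_integral_add) (auto simp: nn_integral_cmult[OF Y] nn_integral_cmult_indicator)
      also have "\<dots> \<le> ennreal (exp \<epsilon>) * 1 + ennreal (real m) * ennreal (measure M (A k))"
        unfolding emeasure_eq_measure by (intro add_right_mono mult_left_mono le1) simp
      also have "\<dots> = ennreal (exp \<epsilon> + real m * measure M (A k))"
        by (simp add: ennreal_mult)
      finally show ?thesis .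
    qed
    moreover have "(\<lambda>k. ennreal (exp \<epsilon> + real m * measure M (A k))) \<longlonglongrightarrow> ennreal (exp \<epsilon> + real m * 0)"
      by (intro tendsto_ennrealI tendsto_intros lim)
    ultimately show ?thesis by (intro LIMSEQ_le_const) auto
  qed
  have trunc1: "(\<integral>\<^sup>+ \<omega>. ennreal (min (real m) (exp (X \<omega>))) \<partial>M) \<le> 1" for m
  proof -
    have "(\<lambda>i. ennreal (exp (inverse (real (Suc i))))) \<longlonglongrightarrow> ennreal (exp 0)"
      by (intro tendsto_ennrealI tendsto_intros LIMSEQ_inverse_real_of_nat)
    then have "(\<lambda>i. ennreal (exp (inverse (real (Suc i))))) \<longlonglongrightarrow> 1" by simp
    then show ?thesis by (rule LIMSEQ_le_const) (use trunc in auto)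
  qed
  have "(\<lambda>m. \<integral>\<^sup>+ \<omega>. ennreal (min (real m) (exp (X \<omega>))) \<partial>M) \<longlonglongrightarrow> (\<integral>\<^sup>+ \<omega>. ennreal (exp (X \<omega>)) \<partial>M)"
  proof (rule nn_integral_LIMSEQ)
    show "incseq (\<lambda>m \<omega>. ennreal (min (real m) (exp (X \<omega>))))"
      by (auto simp: incseq_def le_fun_def intro!: ennreal_leI)
    fix \<omega>
    obtain N :: nat where "exp (X \<omega>) \<le> real N" using real_arch_simple by blast
    then have "\<forall>\<^sub>F m in sequentially. ennreal (min (real m) (exp (X \<omega>))) = ennreal (exp (X \<omega>))"
      by (intro eventually_sequentiallyI[of N]) (auto simp: min_def)
    then show "(\<lambda>m. ennreal (min (real m) (exp (X \<omega>)))) \<longlonglongrightarrow> ennreal (exp (X \<omega>))"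
      by (rule tendsto_eventually)
  qed measurable
  then show ?thesis by (rule LIMSEQ_le_const2) (use trunc1 in auto)
qed

text \<open>The difference of the two sides times \<theta> is a perfect square. Such a weighted
  bound, rather than Cauchy-Schwarz, keeps the error in the energy comparison free of the random
  energy of the limit.\<close>

lemma square_le_perturbed:
  fixes x y \<theta> :: real
  assumes "\<theta> > 0"
  shows "x\<^sup>2 \<le> (1 + \<theta>) * y\<^sup>2 + (1 + 1 / \<theta>) * (x - y)\<^sup>2"
proof -
  have "\<theta> * ((1 + \<theta>) * y\<^sup>2 + (1 + 1 / \<theta>) * (x - y)\<^sup>2 - x\<^sup>2) = (\<theta> * y - (x - y))\<^sup>2"
    using assms by (simp add: field_simps power2_eq_square)
  then have "\<theta> * ((1 + \<theta>) * y\<^sup>2 + (1 + 1 / \<theta>) * (x - y)\<^sup>2 - x\<^sup>2) \<ge> 0" by simp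
  then show ?thesis using assms by (simp add: zero_le_mult_iff)
qed

text \<open>\<open>square_le_perturbed\<close> integrated over the window, the squared distance
  being enlarged to all of [0, T].\<close>

lemma simple_energy_le:
  assumes sp: "simple_process F n \<tau> \<xi>" and st: "0 \<le> s" "s \<le> t" "t \<le> T" and \<theta>: "\<theta> > 0" and \<epsilon>: "\<epsilon> \<ge> 0"
    and H: "continuous_on {0..} (\<lambda>r. H r \<omega>)"
    and Q: "(\<integral>\<^sup>+ r\<in>{0..T}. ennreal ((simple_value n \<tau> \<xi> r \<omega> - H r \<omega>)\<^sup>2) \<partial>lborel) \<le> ennreal \<epsilon>"
  shows "simple_energy n \<tau> \<xi> s t \<omega> \<le> (1 + \<theta>) * integral {s..t} (\<lambda>r. (H r \<omega>)\<^sup>2) + (1 + 1 / \<theta>) * \<epsilon>"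
proof -
  have svm[measurable]: "(\<lambda>r. simple_value n \<tau> \<xi> r \<omega>) \<in> borel_measurable borel"
    unfolding simple_value_def by measurable
  \<comment> \<open>The path is continuous on \<open>{0..}\<close> only; extending it by 0 makes it
    Borel on the whole line without changing either integral.\<close>
  define h where "h r = indicator {0..} r *\<^sub>R H r \<omega>" for r
  have Hm[measurable]: "h \<in> borel_measurable borel"
    unfolding h_def using H by (intro borel_measurable_continuous_on_indicator) auto
  have h: "h r = H r \<omega>" if "0 \<le> r" for r using that by (simp add: h_def)
  have "continuous_on {s..t} (\<lambda>r. (H r \<omega>)\<^sup>2)"
    using H st by (intro continuous_intros) (auto elim: continuous_on_subset)
  then have hi: "((\<lambda>r. (H r \<omega>)\<^sup>2) has_integral integral {s..t} (\<lambda>r. (H r \<omega>)\<^sup>2)) {s..t}"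
    by (intro integrable_integral integrable_continuous_real)
  have i0: "0 \<le> integral {s..t} (\<lambda>r. (H r \<omega>)\<^sup>2)"
    using hi by (rule has_integral_nonneg) simp
  have "ennreal (simple_energy n \<tau> \<xi> s t \<omega>) = (\<integral>\<^sup>+ r\<in>{s<..t}. ennreal ((simple_value n \<tau> \<xi> r \<omega>)\<^sup>2) \<partial>lborel)"
    by (rule simple_value_energy[OF sp st(2), symmetric])
  also have "\<dots> \<le> (\<integral>\<^sup>+ r. ennreal (1 + \<theta>) * (ennreal ((h r)\<^sup>2) * indicator {s..t} r)
      + ennreal (1 + 1 / \<theta>) * (ennreal ((simple_value n \<tau> \<xi> r \<omega> - h r)\<^sup>2) * indicator {0..T} r) \<partial>lborel)"
  proof (rule nn_integral_mono)
    fix r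
    show "ennreal ((simple_value n \<tau> \<xi> r \<omega>)\<^sup>2) * indicator {s<..t} r \<le>
      ennreal (1 + \<theta>) * (ennreal ((h r)\<^sup>2) * indicator {s..t} r)
      + ennreal (1 + 1 / \<theta>) * (ennreal ((simple_value n \<tau> \<xi> r \<omega> - h r)\<^sup>2) * indicator {0..T} r)"
    proof (cases "r \<in> {s<..t}")
      case True
      then show ?thesis
        using st \<theta> square_le_perturbed[OF \<theta>, of "simple_value n \<tau> \<xi> r \<omega>" "H r \<omega>"]
        by (simp add: h ennreal_mult'[symmetric] ennreal_plus[symmetric] ennreal_leI del: ennreal_plus)
    qed simp
  qed
  also have "\<dots> = ennreal (1 + \<theta>) * (\<integral>\<^sup>+ r\<in>{s..t}. ennreal ((h r)\<^sup>2) \<partial>lborel)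
      + ennreal (1 + 1 / \<theta>) * (\<integral>\<^sup>+ r\<in>{0..T}. ennreal ((simple_value n \<tau> \<xi> r \<omega> - h r)\<^sup>2) \<partial>lborel)"
    by (subst nn_integral_add) (auto simp: nn_integral_cmult)
  also have "(\<integral>\<^sup>+ r\<in>{s..t}. ennreal ((h r)\<^sup>2) \<partial>lborel) = (\<integral>\<^sup>+ r\<in>{s..t}. ennreal ((H r \<omega>)\<^sup>2) \<partial>lborel)"
    using st by (intro nn_integral_cong) (auto simp: indicator_def h)
  also have "\<dots> = ennreal (integral {s..t} (\<lambda>r. (H r \<omega>)\<^sup>2))"
    using hi by (intro nn_integral_has_integral_lebesgue') auto
  also have "(\<integral>\<^sup>+ r\<in>{0..T}. ennreal ((simple_value n \<tau> \<xi> r \<omega> - h r)\<^sup>2) \<partial>lborel) =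
      (\<integral>\<^sup>+ r\<in>{0..T}. ennreal ((simple_value n \<tau> \<xi> r \<omega> - H r \<omega>)\<^sup>2) \<partial>lborel)"
    by (intro nn_integral_cong) (auto simp: indicator_def h)
  also have "ennreal (1 + \<theta>) * ennreal (integral {s..t} (\<lambda>r. (H r \<omega>)\<^sup>2)) + ennreal (1 + 1 / \<theta>) * \<dots> \<le>
      ennreal (1 + \<theta>) * ennreal (integral {s..t} (\<lambda>r. (H r \<omega>)\<^sup>2)) + ennreal (1 + 1 / \<theta>) * ennreal \<epsilon>"
    by (intro add_left_mono mult_left_mono Q) simp
  also have "\<dots> = ennreal ((1 + \<theta>) * integral {s..t} (\<lambda>r. (H r \<omega>)\<^sup>2) + (1 + 1 / \<theta>) * \<epsilon>)"
    using \<theta> \<epsilon> i0 by (simp add: ennreal_mult)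
  finally show ?thesis
    using \<theta> \<epsilon> i0 by (subst (asm) ennreal_le_iff) auto
qed

text \<open>Needed so that the exceptional events of the approximation lie in \<open>sets M\<close>:
  for a nonmeasurable set \<open>measure\<close> is 0 by default and its smallness would say
  nothing. Progressive measurability gives joint measurability on [0, t], and integrating out time
  preserves measurability in \<omega>.\<close>

lemma measurable_simple_value_distance:
  assumes BM: "brownian_motion M B" and F: "F = brownian_filtration M B"
    and H: "progressively_measurable F H" and sp: "simple_process F n \<tau> \<xi>" and "0 \<le> t"
  shows "(\<lambda>\<omega>. \<integral>\<^sup>+ s\<in>{0..t}. ennreal ((simple_value n \<tau> \<xi> s \<omega> - H s \<omega>)\<^sup>2) \<partial>lborel) \<in> borel_measurable M"
proof -
  let ?R = "restrict_space lborel {0..t}"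
  interpret R: sigma_finite_measure ?R
    by (rule sigma_finite_measure_restrict_space) (auto simp: lborel.sigma_finite_measure_axioms)
  have Hp: "(\<lambda>(s, \<omega>). H s \<omega>) \<in> borel_measurable (restrict_space borel {0..t} \<Otimes>\<^sub>M F t)"
    using H \<open>0 \<le> t\<close> by (simp add: progressively_measurable_def)
  have idF: "(\<lambda>\<omega>. \<omega>) \<in> measurable M (F t)"
    using measurable_brownian_filtration_imp[OF BM measurable_ident_sets[OF refl], of t] by (simp add: F)
  have [measurable]: "snd \<in> measurable (M \<Otimes>\<^sub>M ?R) (restrict_space borel {0..t})"
  proof -
    have "sets ?R = sets (restrict_space borel {0..t})" by (rule sets_restrict_space_cong) simp
    from measurable_cong_sets[OF refl this] show ?thesis using measurable_snd[of M ?R] by blast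
  qed
  have [measurable]: "(\<lambda>z. fst z) \<in> measurable (M \<Otimes>\<^sub>M ?R) (F t)"
    using measurable_compose[OF measurable_fst idF] .
  have "(\<lambda>z. (snd z, fst z)) \<in> measurable (M \<Otimes>\<^sub>M ?R) (restrict_space borel {0..t} \<Otimes>\<^sub>M F t)"
    by measurable
  from measurable_compose[OF this Hp]
  have [measurable]: "(\<lambda>z. H (snd z) (fst z)) \<in> borel_measurable (M \<Otimes>\<^sub>M ?R)" by simp
  have [measurable]: "\<xi> i \<in> borel_measurable M" if "i < n" for i
    using that sp measurable_brownian_filtration_imp[OF BM, of "\<xi> i" "\<tau> i"] by (auto simp: simple_process_def F)
  have [measurable]: "snd \<in> borel_measurable (M \<Otimes>\<^sub>M ?R)"
    by (rule measurable_compose[OF measurable_snd]) (simp add: measurable_restrict_space1)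
  have "(\<lambda>z. \<xi> i (fst z) * indicator {\<tau> i<..\<tau> (Suc i)} (snd z)) \<in> borel_measurable (M \<Otimes>\<^sub>M ?R)" if "i < n" for i
    using that by measurable
  then have [measurable]: "(\<lambda>z. simple_value n \<tau> \<xi> (snd z) (fst z)) \<in> borel_measurable (M \<Otimes>\<^sub>M ?R)"
    unfolding simple_value_def by (intro borel_measurable_sum) auto
  have "(\<lambda>z. ennreal ((simple_value n \<tau> \<xi> (snd z) (fst z) - H (snd z) (fst z))\<^sup>2)) \<in> borel_measurable (M \<Otimes>\<^sub>M ?R)"
    by measurable
  then have "(\<lambda>\<omega>. \<integral>\<^sup>+ s. ennreal ((simple_value n \<tau> \<xi> s \<omega> - H s \<omega>)\<^sup>2) \<partial>?R) \<in> borel_measurable M"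
    by (intro R.borel_measurable_nn_integral) (simp add: case_prod_unfold)
  then show ?thesis by (simp add: nn_integral_restrict_space)
qed

lemma measurable_energy:
  assumes BM: "brownian_motion M B" and F: "F = brownian_filtration M B"
    and H: "progressively_measurable F H" and cont: "\<And>\<omega>. \<omega> \<in> space M \<Longrightarrow> continuous_on {0..} (\<lambda>t. H t \<omega>)"
    and st: "0 \<le> s" "s \<le> t"
  shows "(\<lambda>\<omega>. integral {s..t} (\<lambda>r. (H r \<omega>)\<^sup>2)) \<in> borel_measurable M"
proof -
  have int: "(\<lambda>r. (H r \<omega>)\<^sup>2) integrable_on {0..u}" if "\<omega> \<in> space M" for u \<omega>
    using cont[OF that] by (intro integrable_continuous_real continuous_intros) (auto elim: continuous_on_subset)
  have m: "(\<lambda>\<omega>. integral {0..u} (\<lambda>r. (H r \<omega>)\<^sup>2)) \<in> borel_measurable M" if u: "0 \<le> u" for u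
  proof -
    \<comment> \<open>The distance of \<open>H\<close> to the empty simple process is its
      energy.\<close>
    have "simple_process F 0 (\<lambda>_. 0) (\<lambda>_ _. 0)" by (simp add: simple_process_def)
    note measurable_simple_value_distance[OF BM F H this u]
    then have "(\<lambda>\<omega>. enn2real (\<integral>\<^sup>+ r\<in>{0..u}. ennreal ((H r \<omega>)\<^sup>2) \<partial>lborel)) \<in> borel_measurable M"
      by (simp add: simple_value_def)
    moreover have "enn2real (\<integral>\<^sup>+ r\<in>{0..u}. ennreal ((H r \<omega>)\<^sup>2) \<partial>lborel) = integral {0..u} (\<lambda>r. (H r \<omega>)\<^sup>2)"
      if "\<omega> \<in> space M" for \<omega>
      using nn_integral_has_integral_lebesgue'[OF _ integrable_integral[OF int[OF that]], of u]
      by (simp add: integral_nonneg int[OF that])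
    ultimately show ?thesis by (subst measurable_cong[symmetric]) auto
  qed
  have eq: "integral {s..t} (\<lambda>r. (H r \<omega>)\<^sup>2) = integral {0..t} (\<lambda>r. (H r \<omega>)\<^sup>2) - integral {0..s} (\<lambda>r. (H r \<omega>)\<^sup>2)"
    if "\<omega> \<in> space M" for \<omega>
    using Henstock_Kurzweil_Integration.integral_combine[OF st int[OF that]] by simp
  have "(\<lambda>\<omega>. integral {0..t} (\<lambda>r. (H r \<omega>)\<^sup>2) - integral {0..s} (\<lambda>r. (H r \<omega>)\<^sup>2)) \<in> borel_measurable M"
    using m[of s] m[of t] st by (intro borel_measurable_diff) auto
  then show ?thesis
    using measurable_cong[of M "\<lambda>\<omega>. integral {s..t} (\<lambda>r. (H r \<omega>)\<^sup>2)"
        "\<lambda>\<omega>. integral {0..t} (\<lambda>r. (H r \<omega>)\<^sup>2) - integral {0..s} (\<lambda>r. (H r \<omega>)\<^sup>2)" borel] eq by blast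
qed

text \<open>For the approximating simple processes the exponential has expectation 1. Outside an
  event of small probability the exponent \<open>X\<close> exceeds theirs by at most \<epsilon>: the
  integrals are close at the finitely many times \<open>t j\<close>, and the slack 1 + \<theta> on
  the energy of \<open>H\<close> pays for replacing the simple energy.\<close>

lemma ito_exp_supermartingale:
  fixes c t :: "nat \<Rightarrow> real" and N :: nat
  assumes BM: "brownian_motion M B" and F: "F = brownian_filtration M B"
    and ito: "ito_integral M F B H I"
    and cont: "\<And>\<omega>. \<omega> \<in> space M \<Longrightarrow> continuous_on {0..} (\<lambda>t. H t \<omega>)"
    and t0: "0 \<le> t 0" and tm: "\<And>j. t j \<le> t (Suc j)" and \<theta>: "\<theta> > 0"
  defines "X \<equiv> \<lambda>\<omega>. \<Sum>j<N. c j * (I (t (Suc j)) \<omega> - I (t j) \<omega>)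
            - (c j)\<^sup>2 / 2 * ((1 + \<theta>) * integral {t j..t (Suc j)} (\<lambda>r. (H r \<omega>)\<^sup>2))"
  shows "X \<in> borel_measurable M" and "(\<integral>\<^sup>+ \<omega>. ennreal (exp (X \<omega>)) \<partial>M) \<le> 1"
proof -
  interpret prob_space M using BM by (simp add: brownian_motion_def)
  have tN: "0 \<le> t j" for j using lift_Suc_mono_le[of t 0 j, OF tm] t0 by simp
  have tle: "t i \<le> t j" if "i \<le> j" for i j using lift_Suc_mono_le[of t i j, OF tm] that by simp
  have H: "progressively_measurable F H" and Im: "\<And>s. 0 \<le> s \<Longrightarrow> I s \<in> borel_measurable (F s)"
    using ito by (auto simp: ito_integral_def)
  have Im[measurable]: "I (t j) \<in> borel_measurable M" for j
    using measurable_brownian_filtration_imp[OF BM, of "I (t j)" "t j"] Im[OF tN] by (simp add: F)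
  from ito obtain n \<tau> \<xi> where sp: "\<And>k. simple_process F (n k) (\<tau> k) (\<xi> k)"
    and limQ: "\<And>s \<epsilon>. 0 \<le> s \<Longrightarrow> \<epsilon> > 0 \<Longrightarrow> (\<lambda>k. measure M {\<omega>\<in>space M.
              (\<integral>\<^sup>+ r\<in>{0..s}. ennreal ((simple_value (n k) (\<tau> k) (\<xi> k) r \<omega> - H r \<omega>)\<^sup>2) \<partial>lborel)
                > ennreal \<epsilon>}) \<longlonglongrightarrow> 0"
    and limI: "\<And>s \<epsilon>. 0 \<le> s \<Longrightarrow> \<epsilon> > 0 \<Longrightarrow> (\<lambda>k. measure M {\<omega>\<in>space M.
              \<bar>simple_integral B (n k) (\<tau> k) (\<xi> k) s \<omega> - I s \<omega>\<bar> > \<epsilon>}) \<longlonglongrightarrow> 0"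
    unfolding ito_integral_def by blast
  define S where "S k = simple_integral B (n k) (\<tau> k) (\<xi> k)" for k
  define V where "V k j = simple_energy (n k) (\<tau> k) (\<xi> k) (t j) (t (Suc j))" for k j
  define J where "J j \<omega> = integral {t j..t (Suc j)} (\<lambda>r. (H r \<omega>)\<^sup>2)" for j \<omega>
  define Q where "Q k \<omega> = (\<integral>\<^sup>+ r\<in>{0..t N}. ennreal ((simple_value (n k) (\<tau> k) (\<xi> k) r \<omega> - H r \<omega>)\<^sup>2) \<partial>lborel)" for k \<omega>
  have Jm[measurable]: "J j \<in> borel_measurable M" for j
    unfolding J_def by (rule measurable_energy[OF BM F H cont tN tm])
  have Qm[measurable]: "Q k \<in> borel_measurable M" for k
    unfolding Q_def by (rule measurable_simple_value_distance[OF BM F H sp tN])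
  have Sm[measurable]: "S k (t j) \<in> borel_measurable M" for k j
  proof -
    have "(\<lambda>\<omega>. \<xi> k i \<omega> * (B (min (t j) (\<tau> k (Suc i))) \<omega> - B (min (t j) (\<tau> k i)) \<omega>)) \<in> borel_measurable M"
      if i: "i < n k" for i
    proof -
      have "0 \<le> \<tau> k 0" using sp by (simp add: simple_process_def)
      then have "0 \<le> \<tau> k i" "0 \<le> \<tau> k (Suc i)"
        using simple_process_mono[OF sp, of 0 i k] simple_process_mono[OF sp, of 0 "Suc i" k] i by auto
      then have "B (min (t j) (\<tau> k (Suc i))) \<in> borel_measurable M" "B (min (t j) (\<tau> k i)) \<in> borel_measurable M"
        using BM tN[of j] by (auto simp: brownian_motion_def)
      moreover have "\<xi> k i \<in> borel_measurable M"
        using measurable_brownian_filtration_imp[OF BM, of "\<xi> k i" "\<tau> k i"] sp[of k] i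
        by (auto simp: simple_process_def F)
      ultimately show ?thesis by measurable
    qed
    then show ?thesis unfolding S_def simple_integral_def by (intro borel_measurable_sum) auto
  qed
  let ?X = "\<lambda>\<omega>. \<Sum>j<N. c j * (I (t (Suc j)) \<omega> - I (t j) \<omega>) - (c j)\<^sup>2 / 2 * ((1 + \<theta>) * J j \<omega>)"
  let ?Y = "\<lambda>k \<omega>. \<Sum>j<N. c j * (S k (t (Suc j)) \<omega> - S k (t j) \<omega>) - (c j)\<^sup>2 / 2 * V k j \<omega>"
  have Xm: "?X \<in> borel_measurable M" by measurable
  then show "X \<in> borel_measurable M" unfolding X_def J_def .
  have "(\<integral>\<^sup>+ \<omega>. ennreal (exp (?X \<omega>)) \<partial>M) \<le> 1"
  proof (rule nn_integral_exp_le_1_limit_in_probability[OF Xm])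
    show "(\<lambda>\<omega>. ennreal (exp (?Y k \<omega>))) \<in> borel_measurable M" for k
      unfolding S_def V_def by (rule simple_exp_martingale(2)[OF BM F sp t0 tm])
    show "(\<integral>\<^sup>+ \<omega>. ennreal (exp (?Y k \<omega>)) \<partial>M) \<le> 1" for k
      unfolding S_def V_def by (subst simple_exp_martingale(1)[OF BM F sp t0 tm]) simp
    fix \<epsilon> :: real assume "\<epsilon> > 0"
    \<comment> \<open>Total error per unit of tolerance: each increment of \<open>I\<close> is off
      at both of its ends, hence the 2, and each energy is off by
      \<open>(1 + 1 / \<theta>) * \<eta>\<close>. Dividing by \<open>C + 1\<close> below keeps
      \<eta> defined when \<open>C\<close> is 0.\<close>
    define C where "C = (\<Sum>j<N. \<bar>c j\<bar> * 2 + (c j)\<^sup>2 / 2 * (1 + 1 / \<theta>))"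
    have C: "C \<ge> 0" unfolding C_def using \<theta> by (intro sum_nonneg) auto
    define \<eta> where "\<eta> = \<epsilon> / (C + 1)"
    have \<eta>: "\<eta> > 0" "C * \<eta> \<le> \<epsilon>" using C \<open>\<epsilon> > 0\<close> by (auto simp: \<eta>_def field_simps)
    define A1 where "A1 k = {\<omega>\<in>space M. Q k \<omega> > ennreal \<eta>}" for k
    define A2 where "A2 k j = {\<omega>\<in>space M. \<bar>S k (t j) \<omega> - I (t j) \<omega>\<bar> > \<eta>}" for k j
    have A1m[measurable]: "A1 k \<in> sets M" for k unfolding A1_def by measurable
    have A2m[measurable]: "A2 k j \<in> sets M" for k j unfolding A2_def by measurable
    show "\<exists>A. (\<forall>k. A k \<in> sets M) \<and> (\<lambda>k. measure M (A k)) \<longlonglongrightarrow> 0 \<and>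
        (\<forall>k. \<forall>\<omega>\<in>space M - A k. ?X \<omega> \<le> ?Y k \<omega> + \<epsilon>)"
    proof (intro exI[of _ "\<lambda>k. A1 k \<union> (\<Union>j\<in>{..N}. A2 k j)"] conjI allI ballI)
      show "A1 k \<union> (\<Union>j\<in>{..N}. A2 k j) \<in> sets M" for k by measurable
      have "(\<lambda>k. measure M (A1 k) + (\<Sum>j\<le>N. measure M (A2 k j))) \<longlonglongrightarrow> 0 + (\<Sum>j\<le>N. 0)"
        unfolding A1_def A2_def Q_def S_def by (intro tendsto_add tendsto_sum limQ limI tN \<eta>)
      then have lim: "(\<lambda>k. measure M (A1 k) + (\<Sum>j\<le>N. measure M (A2 k j))) \<longlonglongrightarrow> 0" by simp
      have le: "measure M (A1 k \<union> (\<Union>j\<in>{..N}. A2 k j)) \<le> measure M (A1 k) + (\<Sum>j\<le>N. measure M (A2 k j))" for k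
        by (rule order_trans[OF measure_Un_le add_left_mono[OF measure_UNION_le]]) auto
      show "(\<lambda>k. measure M (A1 k \<union> (\<Union>j\<in>{..N}. A2 k j))) \<longlonglongrightarrow> 0"
        by (rule tendsto_sandwich[OF _ _ tendsto_const lim]) (use le in auto)
      fix k \<omega> assume \<omega>: "\<omega> \<in> space M - (A1 k \<union> (\<Union>j\<in>{..N}. A2 k j))"
      have close: "\<bar>S k (t j) \<omega> - I (t j) \<omega>\<bar> \<le> \<eta>" if "j \<le> N" for j
        using \<omega> that by (force simp: A2_def)
      have V: "V k j \<omega> \<le> (1 + \<theta>) * J j \<omega> + (1 + 1 / \<theta>) * \<eta>" if "j < N" for j
        unfolding V_def J_def
      proof (rule simple_energy_le[OF sp tN tm])
        show "(\<integral>\<^sup>+ r\<in>{0..t N}. ennreal ((simple_value (n k) (\<tau> k) (\<xi> k) r \<omega> - H r \<omega>)\<^sup>2) \<partial>lborel) \<le> ennreal \<eta>"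
          using \<omega> by (auto simp: A1_def Q_def)
      qed (use \<omega> \<theta> \<eta> cont tle that in auto)
      have "?X \<omega> - ?Y k \<omega> \<le> (\<Sum>j<N. (\<bar>c j\<bar> * 2 + (c j)\<^sup>2 / 2 * (1 + 1 / \<theta>)) * \<eta>)"
        unfolding sum_subtractf[symmetric]
      proof (rule sum_mono)
        fix j assume "j \<in> {..<N}"
        then have j: "j < N" by simp
        have "c j * ((I (t (Suc j)) \<omega> - I (t j) \<omega>) - (S k (t (Suc j)) \<omega> - S k (t j) \<omega>))
            \<le> \<bar>c j\<bar> * \<bar>(I (t (Suc j)) \<omega> - I (t j) \<omega>) - (S k (t (Suc j)) \<omega> - S k (t j) \<omega>)\<bar>"
          by (metis abs_ge_self abs_mult)
        also have "\<dots> \<le> \<bar>c j\<bar> * (2 * \<eta>)"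
          using close[of j] close[of "Suc j"] j by (intro mult_left_mono) auto
        finally have 1: "c j * ((I (t (Suc j)) \<omega> - I (t j) \<omega>) - (S k (t (Suc j)) \<omega> - S k (t j) \<omega>)) \<le> \<bar>c j\<bar> * (2 * \<eta>)" .
        have 2: "(c j)\<^sup>2 / 2 * (V k j \<omega> - (1 + \<theta>) * J j \<omega>) \<le> (c j)\<^sup>2 / 2 * ((1 + 1 / \<theta>) * \<eta>)"
          using V[OF j] by (intro mult_left_mono) auto
        show "c j * (I (t (Suc j)) \<omega> - I (t j) \<omega>) - (c j)\<^sup>2 / 2 * ((1 + \<theta>) * J j \<omega>) -
            (c j * (S k (t (Suc j)) \<omega> - S k (t j) \<omega>) - (c j)\<^sup>2 / 2 * V k j \<omega>)
            \<le> (\<bar>c j\<bar> * 2 + (c j)\<^sup>2 / 2 * (1 + 1 / \<theta>)) * \<eta>"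
          using add_mono[OF 1 2] by (simp add: algebra_simps)
      qed
      also have "\<dots> = C * \<eta>" by (simp add: C_def sum_distrib_right)
      finally show "?X \<omega> \<le> ?Y k \<omega> + \<epsilon>" using \<eta>(2) by linarith
    qed
  qed
  then show "(\<integral>\<^sup>+ \<omega>. ennreal (exp (X \<omega>)) \<partial>M) \<le> 1" unfolding X_def J_def .
qed

text \<open>The definition of \<open>ito_integral\<close> does not state the initial value. At time
  0 every simple integral vanishes, so the probabilities converging to 0 do not depend on
  \<open>k\<close> and are therefore 0.\<close>

lemma ito_integral_0:
  assumes BM: "brownian_motion M B" and F: "F = brownian_filtration M B"
    and ito: "ito_integral M F B H I"
  shows "AE \<omega> in M. I 0 \<omega> = 0"
proof -
  interpret prob_space M using BM by (simp add: brownian_motion_def)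
  have Im[measurable]: "I 0 \<in> borel_measurable M"
    using measurable_brownian_filtration_imp[OF BM, of "I 0" 0] ito by (auto simp: F ito_integral_def)
  from ito obtain n \<tau> \<xi> where sp: "\<And>k. simple_process F (n k) (\<tau> k) (\<xi> k)"
    and limI: "\<And>\<epsilon>. \<epsilon> > 0 \<Longrightarrow> (\<lambda>k. measure M {\<omega>\<in>space M.
              \<bar>simple_integral B (n k) (\<tau> k) (\<xi> k) 0 \<omega> - I 0 \<omega>\<bar> > \<epsilon>}) \<longlonglongrightarrow> 0"
    unfolding ito_integral_def by blast
  have z: "simple_integral B (n k) (\<tau> k) (\<xi> k) 0 \<omega> = 0" for k \<omega>
    unfolding simple_integral_def
  proof (intro sum.neutral ballI)
    fix i assume "i \<in> {..<n k}"
    moreover have "0 \<le> \<tau> k 0" using sp by (simp add: simple_process_def)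
    ultimately have "0 \<le> \<tau> k i" "0 \<le> \<tau> k (Suc i)"
      using simple_process_mono[OF sp, of 0 i k] simple_process_mono[OF sp, of 0 "Suc i" k] by auto
    then show "\<xi> k i \<omega> * (B (min 0 (\<tau> k (Suc i))) \<omega> - B (min 0 (\<tau> k i)) \<omega>) = 0" by simp
  qed
  have "AE \<omega> in M. \<bar>I 0 \<omega>\<bar> \<le> \<epsilon>" if "\<epsilon> > 0" for \<epsilon>
  proof -
    have "measure M {\<omega>\<in>space M. \<bar>I 0 \<omega>\<bar> > \<epsilon>} = 0"
      using limI[OF that] by (simp add: z LIMSEQ_const_iff)
    then have "AE \<omega> in M. \<omega> \<notin> {\<omega>\<in>space M. \<bar>I 0 \<omega>\<bar> > \<epsilon>}"
      by (intro AE_not_in) (simp add: null_sets_def emeasure_eq_measure)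
    then show ?thesis using AE_space by eventually_elim auto
  qed
  then have "AE \<omega> in M. \<forall>i::nat. \<bar>I 0 \<omega>\<bar> \<le> inverse (real (Suc i))"
    unfolding AE_all_countable by simp
  then show ?thesis
  proof eventually_elim
    case (elim \<omega>)
    then have "\<bar>I 0 \<omega>\<bar> \<le> 0" using LIMSEQ_le_const[OF LIMSEQ_inverse_real_of_nat, of "\<bar>I 0 \<omega>\<bar>"] by auto
    then show ?case by simp
  qed
qed

subsection \<open>The Laplace transform of the squared Bessel process\<close>

lemma sum_integral_consecutive:
  fixes h :: "real \<Rightarrow> real"
  assumes "\<And>j. t j \<le> t (Suc j)" and "h integrable_on {t 0..t m}"
  shows "(\<Sum>j<m. integral {t j..t (Suc j)} h) = integral {t 0..t m} h"
  using assms(2)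
proof (induction m)
  case (Suc m)
  have m: "t 0 \<le> t m" using lift_Suc_mono_le[of t 0 m, OF assms(1)] by simp
  have "h integrable_on {t 0..t m}"
    by (rule integrable_subinterval_real[OF Suc.prems]) (use assms(1)[of m] in auto)
  then show ?case
    using Suc Henstock_Kurzweil_Integration.integral_combine[OF m assms(1)[of m] Suc.prems] by simp
qed simp

text \<open>Uniform continuity of \<open>f\<close> bounds each local error by a small multiple of
  the integral of |g|. The tag is arbitrary because the application samples \<open>u\<close> at left
  endpoints and \<open>Z\<close> at right endpoints.\<close>

lemma tagged_sum_tendsto_integral:
  fixes f g :: "real \<Rightarrow> real" and tag :: "nat \<Rightarrow> nat \<Rightarrow> real"
  assumes T: "0 \<le> T" and f: "continuous_on {0..T} f" and g: "continuous_on {0..T} g"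
  defines "t \<equiv> \<lambda>n j. T * real j / real (Suc n)"
  assumes tag: "\<And>n j. tag n j \<in> {t n j..t n (Suc j)}"
  shows "(\<lambda>n. \<Sum>j<Suc n. f (tag n j) * integral {t n j..t n (Suc j)} g) \<longlonglongrightarrow> integral {0..T} (\<lambda>s. f s * g s)"
proof (rule LIMSEQ_I)
  fix e :: real assume e: "0 < e"
  define G where "G = integral {0..T} (\<lambda>s. \<bar>g s\<bar>)"
  have G: "G \<ge> 0" unfolding G_def by (rule integral_nonneg) (use g in \<open>auto intro!: integrable_continuous_real continuous_intros\<close>)
  have "uniformly_continuous_on {0..T} f" using f by (rule compact_uniformly_continuous) simp
  moreover have "e / (G + 1) > 0" using e G by simp
  ultimately obtain d where d: "d > 0"
    "\<And>x y. x \<in> {0..T} \<Longrightarrow> y \<in> {0..T} \<Longrightarrow> dist y x < d \<Longrightarrow> dist (f y) (f x) < e / (G + 1)"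
    unfolding uniformly_continuous_on_def by metis
  obtain N :: nat where N: "real N > T / d" using reals_Archimedean2 by blast
  show "\<exists>no. \<forall>n\<ge>no. norm ((\<Sum>j<Suc n. f (tag n j) * integral {t n j..t n (Suc j)} g) - integral {0..T} (\<lambda>s. f s * g s)) < e"
  proof (intro exI[of _ N] allI impI)
    fix n assume n: "n \<ge> N"
    have t_mono: "t n j \<le> t n (Suc j)" for j using T by (auto simp: t_def field_simps)
    have t0: "t n 0 = 0" and tN: "t n (Suc n) = T" by (simp_all add: t_def del: of_nat_Suc)
    have step: "t n (Suc j) - t n j < d" for j
    proof -
      have "t n (Suc j) - t n j = T / real (Suc n)" 
        unfolding t_def diff_divide_distrib[symmetric] by (simp add: algebra_simps)
      also have "\<dots> < d"
      proof -
        have "T < d * real N" using N d by (simp add: field_simps)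
        also have "\<dots> \<le> d * real (Suc n)" using n d by (intro mult_left_mono) auto
        finally show ?thesis by (simp add: field_simps)
      qed
      finally show ?thesis .
    qed
    have sub: "{t n j..t n (Suc j)} \<subseteq> {0..T}" if "j < Suc n" for j
    proof -
      have "t n 0 \<le> t n j" "t n (Suc j) \<le> t n (Suc n)"
        using that by (auto intro: lift_Suc_mono_le[of "t n", OF t_mono])
      then show ?thesis using t0 tN by auto
    qed
    have int: "h integrable_on {t n j..t n (Suc j)}" if "continuous_on {0..T} h" "j < Suc n" for h :: "real \<Rightarrow> real" and j
      using that sub by (intro integrable_continuous_real) (blast intro: continuous_on_subset)
    have fg: "continuous_on {0..T} (\<lambda>s. f s * g s)" and ag: "continuous_on {0..T} (\<lambda>s. \<bar>g s\<bar>)"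
      using f g by (auto intro!: continuous_intros)
    have split: "integral {0..T} h = (\<Sum>j<Suc n. integral {t n j..t n (Suc j)} h)" if "continuous_on {0..T} h" for h :: "real \<Rightarrow> real"
      using sum_integral_consecutive[of "t n" h "Suc n"] t_mono that t0 tN by (simp add: integrable_continuous_real)
    have "(\<Sum>j<Suc n. f (tag n j) * integral {t n j..t n (Suc j)} g) - integral {0..T} (\<lambda>s. f s * g s) =
      (\<Sum>j<Suc n. integral {t n j..t n (Suc j)} (\<lambda>s. (f (tag n j) - f s) * g s))"
      unfolding split[OF fg] sum_subtractf[symmetric]
    proof (rule sum.cong[OF refl])
      fix j assume j: "j \<in> {..<Suc n}"
      have "integral {t n j..t n (Suc j)} (\<lambda>s. (f (tag n j) - f s) * g s) =
         integral {t n j..t n (Suc j)} (\<lambda>s. f (tag n j) * g s) - integral {t n j..t n (Suc j)} (\<lambda>s. f s * g s)"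
        using j int[OF continuous_on_mult_left[OF g], of j "f (tag n j)"] int[OF fg]
          Henstock_Kurzweil_Integration.integral_diff[of "\<lambda>s. f (tag n j) * g s" "{t n j..t n (Suc j)}" "\<lambda>s. f s * g s"]
        by (simp add: left_diff_distrib)
      then show "f (tag n j) * integral {t n j..t n (Suc j)} g - integral {t n j..t n (Suc j)} (\<lambda>s. f s * g s)
        = integral {t n j..t n (Suc j)} (\<lambda>s. (f (tag n j) - f s) * g s)" by simp
    qed
    also have "norm \<dots> \<le> (\<Sum>j<Suc n. e / (G + 1) * integral {t n j..t n (Suc j)} (\<lambda>s. \<bar>g s\<bar>))"
    proof (rule sum_norm_le)
      fix j assume j: "j \<in> {..<Suc n}"
      then have jn: "j < Suc n" by simp
      have "norm (integral {t n j..t n (Suc j)} (\<lambda>s. (f (tag n j) - f s) * g s)) \<le>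
          integral {t n j..t n (Suc j)} (\<lambda>s. e / (G + 1) * \<bar>g s\<bar>)"
      proof (rule integral_norm_bound_integral)
        show "(\<lambda>s. (f (tag n j) - f s) * g s) integrable_on {t n j..t n (Suc j)}"
          using f g jn by (intro int) (auto intro!: continuous_intros)
        show "(\<lambda>s. e / (G + 1) * \<bar>g s\<bar>) integrable_on {t n j..t n (Suc j)}"
          by (rule int[OF continuous_on_mult_left[OF ag] jn])
        fix s assume s: "s \<in> {t n j..t n (Suc j)}"
        have "dist (tag n j) s < d" using s tag[of n j] step[of j] by (auto simp: dist_real_def)
        then have "dist (f (tag n j)) (f s) < e / (G + 1)"
          using d(2)[of s "tag n j"] s tag[of n j] sub[OF jn] by auto
        then have "\<bar>f (tag n j) - f s\<bar> * \<bar>g s\<bar> \<le> e / (G + 1) * \<bar>g s\<bar>"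
          by (intro mult_right_mono) (auto simp: dist_real_def)
        then show "norm ((f (tag n j) - f s) * g s) \<le> e / (G + 1) * \<bar>g s\<bar>"
          by (simp only: real_norm_def abs_mult)
      qed
      then show "norm (integral {t n j..t n (Suc j)} (\<lambda>s. (f (tag n j) - f s) * g s)) \<le>
          e / (G + 1) * integral {t n j..t n (Suc j)} (\<lambda>s. \<bar>g s\<bar>)" by simp
    qed
    also have "\<dots> = e / (G + 1) * G"
      unfolding sum_distrib_left[symmetric] G_def split[OF ag] ..
    also have "\<dots> < e" using e G by (simp add: field_simps)
    finally show "norm ((\<Sum>j<Suc n. f (tag n j) * integral {t n j..t n (Suc j)} g) - integral {0..T} (\<lambda>s. f s * g s)) < e" .
  qed
qed

text \<open>
  The function \<open>u\<close> solves the Riccati equation \<open>u' = 2 u\<^sup>2\<close>, which makes the two integrals of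
  \<open>u\<^sup>2 Z\<close> in the limit of the exponents cancel.
\<close>

lemma squared_bessel_laplace_le:
  assumes sol: "squared_bessel_strong_solution M B \<delta> x Z" and T: "0 \<le> T" and l: "0 \<le> l"
  shows "(\<integral>\<^sup>+ \<omega>. ennreal (exp (- l * Z T \<omega>)) \<partial>M) \<le>
    ennreal ((1 + 2 * l * T) powr (- \<delta> / 2) * exp (- l * x\<^sup>2 / (1 + 2 * l * T)))"
proof -
  from sol obtain I where BM: "brownian_motion M B"
    and Zm: "\<And>s. 0 \<le> s \<Longrightarrow> Z s \<in> borel_measurable (brownian_filtration M B s)"
    and Zc: "\<And>\<omega>. \<omega> \<in> space M \<Longrightarrow> continuous_on {0..} (\<lambda>s. Z s \<omega>)"
    and Zp: "\<And>\<omega> s. \<omega> \<in> space M \<Longrightarrow> 0 \<le> s \<Longrightarrow> 0 \<le> Z s \<omega>"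
    and ito: "ito_integral M (brownian_filtration M B) B (\<lambda>s \<omega>. 2 * sqrt (Z s \<omega>)) I"
    and eq: "AE \<omega> in M. \<forall>s\<ge>0. Z s \<omega> = x\<^sup>2 + I s \<omega> + \<delta> * s"
    unfolding squared_bessel_strong_solution_def by blast
  interpret prob_space M using BM by (simp add: brownian_motion_def)
  have ZT[measurable]: "Z T \<in> borel_measurable M"
    using measurable_brownian_filtration_imp[OF BM Zm[OF T]] .
  \<comment> \<open>The terminal value \<open>u T = l\<close> produces \<open>l * Z T\<close> as
    boundary term; the initial value \<open>u 0\<close> supplies the coefficient of
    \<open>x\<^sup>2\<close> in the bound.\<close>
  define u where "u s = l / (1 + 2 * l * (T - s))" for s
  have den: "1 + 2 * l * (T - s) > 0" if "s \<le> T" for s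
    using l that by (intro add_pos_nonneg) auto
  have uc: "continuous_on {0..T} u"
    unfolding u_def using den by (intro continuous_intros) force
  have du: "(u has_vector_derivative 2 * (u s)\<^sup>2) (at s within A)" if "s \<le> T" for s A
  proof -
    have "1 + 2 * l * (T - s) \<noteq> 0" using den[OF that] by simp
    then have "(u has_real_derivative 2 * (u s)\<^sup>2) (at s within A)"
      unfolding u_def by (auto intro!: derivative_eq_intros simp: field_simps power2_eq_square)
    then show ?thesis by (simp add: has_real_derivative_iff_has_vector_derivative)
  qed
  \<comment> \<open>The drift contributes \<delta> times this integral, which becomes the power with
    exponent \<delta>/2.\<close>
  have u_int: "integral {0..T} u = ln (1 + 2 * l * T) / 2"
  proof -
    have "((\<lambda>s. - ln (1 + 2 * l * (T - s)) / 2) has_vector_derivative u s) (at s within {0..T})" if "s \<in> {0..T}" for s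
    proof -
      have "((\<lambda>s. - ln (1 + 2 * l * (T - s)) / 2) has_real_derivative u s) (at s within {0..T})"
        unfolding u_def using den[of s] that by (auto intro!: derivative_eq_intros simp: field_simps)
      then show ?thesis by (simp add: has_real_derivative_iff_has_vector_derivative)
    qed
    from fundamental_theorem_of_calculus[OF T this] show ?thesis by (simp add: integral_unique)
  qed
  define t where "t n j = T * real j / real (Suc n)" for n j
  have t_mono: "t n j \<le> t n (Suc j)" for n j using T by (auto simp: t_def field_simps)
  have t0: "t n 0 = 0" and tN: "t n (Suc n) = T" for n by (simp_all add: t_def del: of_nat_Suc)
  have t_pos: "0 \<le> t n j" for n j using T by (simp add: t_def)
  have t_le: "t n j \<le> T" if "j \<le> Suc n" for n j
    using lift_Suc_mono_le[of "t n", OF t_mono that] tN by simp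
  \<comment> \<open>The slack shrinks together with the mesh, so a single limit removes
    both.\<close>
  define \<theta> where "\<theta> n = inverse (real (Suc n))" for n
  have Hc: "continuous_on {0..} (\<lambda>s. 2 * sqrt (Z s \<omega>))" if "\<omega> \<in> space M" for \<omega>
    using Zc[OF that] by (intro continuous_intros)
  define X where "X n \<omega> = (\<Sum>j<Suc n. - u (t n j) * (I (t n (Suc j)) \<omega> - I (t n j) \<omega>)
      - (- u (t n j))\<^sup>2 / 2 * ((1 + \<theta> n) * integral {t n j..t n (Suc j)} (\<lambda>r. (2 * sqrt (Z r \<omega>))\<^sup>2)))" for n \<omega>
  have \<theta>: "\<theta> n > 0" for n by (simp add: \<theta>_def)
  have Xm[measurable]: "X n \<in> borel_measurable M" and X1: "(\<integral>\<^sup>+ \<omega>. ennreal (exp (X n \<omega>)) \<partial>M) \<le> 1" for n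
    using ito_exp_supermartingale[OF BM refl ito Hc t_pos[of n 0] t_mono[of n] \<theta>[of n], where N = "Suc n" and c = "\<lambda>j. - u (t n j)"]
    by (auto simp: X_def[abs_def])
  define L where "L \<omega> = - l * Z T \<omega> + u 0 * x\<^sup>2 + \<delta> / 2 * ln (1 + 2 * l * T)" for \<omega>
  have lim: "AE \<omega> in M. (\<lambda>n. X n \<omega>) \<longlonglongrightarrow> L \<omega>"
    using eq ito_integral_0[OF BM refl ito] AE_space
  proof eventually_elim
    case (elim \<omega>)
    then have I: "I s \<omega> = Z s \<omega> - x\<^sup>2 - \<delta> * s" if "0 \<le> s" for s using that by (auto simp: algebra_simps)
    have Z0: "Z 0 \<omega> = x\<^sup>2" using elim by auto
    have Zc': "continuous_on {0..T} (\<lambda>s. Z s \<omega>)"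
      using Zc[OF elim(3)] by (rule continuous_on_subset) auto
    have u2c: "continuous_on {0..T} (\<lambda>s. (u s)\<^sup>2)" "continuous_on {0..T} (\<lambda>s. 2 * (u s)\<^sup>2)"
      using uc by (auto intro!: continuous_intros)
    \<comment> \<open>Discrete summation by parts takes the place of the product rule: minus u at
      the left end times the increment of Z equals Z at the right end times the increment of u,
      minus the increment of u Z. The increment of u is the integral of its derivative, and the
      increments of u Z telescope.\<close>
    have X: "X n \<omega> = (\<Sum>j<Suc n. Z (t n (Suc j)) \<omega> * integral {t n j..t n (Suc j)} (\<lambda>s. 2 * (u s)\<^sup>2))
        + \<delta> * (\<Sum>j<Suc n. u (t n j) * integral {t n j..t n (Suc j)} (\<lambda>_. 1))
        - 2 * (1 + \<theta> n) * (\<Sum>j<Suc n. (u (t n j))\<^sup>2 * integral {t n j..t n (Suc j)} (\<lambda>s. Z s \<omega>))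
        - (l * Z T \<omega> - u 0 * x\<^sup>2)" for n
    proof -
      have "integral {t n j..t n (Suc j)} (\<lambda>r. (2 * sqrt (Z r \<omega>))\<^sup>2) = 4 * integral {t n j..t n (Suc j)} (\<lambda>r. Z r \<omega>)" for j
      proof -
        have "integral {t n j..t n (Suc j)} (\<lambda>r. (2 * sqrt (Z r \<omega>))\<^sup>2) = integral {t n j..t n (Suc j)} (\<lambda>r. 4 * Z r \<omega>)"
          using Zp[OF elim(3)] t_pos[of n j] by (intro integral_cong) (simp add: power_mult_distrib)
        then show ?thesis by simp
      qed
      then have "X n \<omega> = (\<Sum>j<Suc n. - u (t n j) * (I (t n (Suc j)) \<omega> - I (t n j) \<omega>)
          - 2 * (1 + \<theta> n) * ((u (t n j))\<^sup>2 * integral {t n j..t n (Suc j)} (\<lambda>s. Z s \<omega>)))"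
        unfolding X_def by (intro sum.cong refl) (simp add: algebra_simps)
      also have "\<dots> = (\<Sum>j<Suc n. Z (t n (Suc j)) \<omega> * integral {t n j..t n (Suc j)} (\<lambda>s. 2 * (u s)\<^sup>2)
          + \<delta> * (u (t n j) * integral {t n j..t n (Suc j)} (\<lambda>_. 1))
          - 2 * (1 + \<theta> n) * ((u (t n j))\<^sup>2 * integral {t n j..t n (Suc j)} (\<lambda>s. Z s \<omega>))
          - (u (t n (Suc j)) * Z (t n (Suc j)) \<omega> - u (t n j) * Z (t n j) \<omega>))"
      proof (rule sum.cong[OF refl])
        fix j assume "j \<in> {..<Suc n}"
        then have "t n (Suc j) \<le> T" by (intro t_le) simp
        then have "((\<lambda>s. 2 * (u s)\<^sup>2) has_integral (u (t n (Suc j)) - u (t n j))) {t n j..t n (Suc j)}"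
          using t_mono by (intro fundamental_theorem_of_calculus du) auto
        then have u_incr: "integral {t n j..t n (Suc j)} (\<lambda>s. 2 * (u s)\<^sup>2) = u (t n (Suc j)) - u (t n j)"
          by (rule integral_unique)
        have t_incr: "integral {t n j..t n (Suc j)} (\<lambda>_. 1::real) = t n (Suc j) - t n j"
          using t_mono[of n j] by simp
        show "- u (t n j) * (I (t n (Suc j)) \<omega> - I (t n j) \<omega>)
          - 2 * (1 + \<theta> n) * ((u (t n j))\<^sup>2 * integral {t n j..t n (Suc j)} (\<lambda>s. Z s \<omega>)) =
          Z (t n (Suc j)) \<omega> * integral {t n j..t n (Suc j)} (\<lambda>s. 2 * (u s)\<^sup>2)
          + \<delta> * (u (t n j) * integral {t n j..t n (Suc j)} (\<lambda>_. 1))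
          - 2 * (1 + \<theta> n) * ((u (t n j))\<^sup>2 * integral {t n j..t n (Suc j)} (\<lambda>s. Z s \<omega>))
          - (u (t n (Suc j)) * Z (t n (Suc j)) \<omega> - u (t n j) * Z (t n j) \<omega>)"
          unfolding u_incr t_incr I[OF t_pos] by (simp add: algebra_simps)
      qed
      also have "\<dots> = (\<Sum>j<Suc n. Z (t n (Suc j)) \<omega> * integral {t n j..t n (Suc j)} (\<lambda>s. 2 * (u s)\<^sup>2))
        + \<delta> * (\<Sum>j<Suc n. u (t n j) * integral {t n j..t n (Suc j)} (\<lambda>_. 1))
        - 2 * (1 + \<theta> n) * (\<Sum>j<Suc n. (u (t n j))\<^sup>2 * integral {t n j..t n (Suc j)} (\<lambda>s. Z s \<omega>))
        - (\<Sum>j<Suc n. u (t n (Suc j)) * Z (t n (Suc j)) \<omega> - u (t n j) * Z (t n j) \<omega>)"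
        unfolding sum_subtractf sum.distrib sum_distrib_left ..
      also have "(\<Sum>j<Suc n. u (t n (Suc j)) * Z (t n (Suc j)) \<omega> - u (t n j) * Z (t n j) \<omega>) = l * Z T \<omega> - u 0 * x\<^sup>2"
        by (subst sum_lessThan_telescope[of "\<lambda>j. u (t n j) * Z (t n j) \<omega>"]) (simp add: t0 tN Z0, simp add: u_def)
      finally show ?thesis .
    qed
    have "(\<lambda>n. X n \<omega>) \<longlonglongrightarrow> integral {0..T} (\<lambda>s. Z s \<omega> * (2 * (u s)\<^sup>2)) + \<delta> * integral {0..T} (\<lambda>s. u s * 1)
        - 2 * (1 + 0) * integral {0..T} (\<lambda>s. (u s)\<^sup>2 * Z s \<omega>) - (l * Z T \<omega> - u 0 * x\<^sup>2)"
      unfolding X \<theta>_def t_def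
      by (intro tendsto_diff tendsto_add tendsto_mult tendsto_const LIMSEQ_inverse_real_of_nat
          tagged_sum_tendsto_integral T Zc' uc u2c continuous_on_const)
        (use t_mono in \<open>auto simp: t_def\<close>)
    also have "integral {0..T} (\<lambda>s. Z s \<omega> * (2 * (u s)\<^sup>2)) = 2 * integral {0..T} (\<lambda>s. (u s)\<^sup>2 * Z s \<omega>)"
      by (subst integral_mult_right[symmetric]) (simp add: mult_ac)
    finally show ?case by (simp add: u_int L_def algebra_simps)
  qed
  have "(\<integral>\<^sup>+ \<omega>. ennreal (exp (L \<omega>)) \<partial>M) \<le> 1"
  proof -
    \<comment> \<open>Fatou's lemma along the refining partitions; the convergence is almost sure
      here, since it is pathwise Riemann summation.\<close>
    have "(\<integral>\<^sup>+ \<omega>. ennreal (exp (L \<omega>)) \<partial>M) = (\<integral>\<^sup>+ \<omega>. liminf (\<lambda>n. ennreal (exp (X n \<omega>))) \<partial>M)"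
    proof (rule nn_integral_cong_AE)
      show "AE \<omega> in M. ennreal (exp (L \<omega>)) = liminf (\<lambda>n. ennreal (exp (X n \<omega>)))"
        using lim
      proof eventually_elim
        case (elim \<omega>)
        then have "(\<lambda>n. ennreal (exp (X n \<omega>))) \<longlonglongrightarrow> ennreal (exp (L \<omega>))"
          by (intro tendsto_ennrealI tendsto_exp)
        from lim_imp_Liminf[OF _ this] show ?case by simp
      qed
    qed
    also have "\<dots> \<le> liminf (\<lambda>n. \<integral>\<^sup>+ \<omega>. ennreal (exp (X n \<omega>)) \<partial>M)"
      by (rule nn_integral_liminf) measurable
    also have "\<dots> \<le> limsup (\<lambda>n. \<integral>\<^sup>+ \<omega>. ennreal (exp (X n \<omega>)) \<partial>M)" by (rule Liminf_le_Limsup) simp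
    also have "\<dots> \<le> 1" by (rule Limsup_bounded) (use X1 in auto)
    finally show ?thesis .
  qed
  \<comment> \<open>The deterministic part of \<open>exp (L \<omega>)\<close>; its reciprocal is the
    bound to be proved.\<close>
  define k where "k = exp (u 0 * x\<^sup>2 + \<delta> / 2 * ln (1 + 2 * l * T))"
  have k: "k > 0" by (simp add: k_def)
  have Lk: "exp (- l * Z T \<omega>) = 1 / k * exp (L \<omega>)" for \<omega>
  proof -
    have "exp (L \<omega>) = k * exp (- l * Z T \<omega>)"
      unfolding L_def k_def mult_exp_exp by (simp add: algebra_simps)
    then show ?thesis using k by simp
  qed
  have Lm[measurable]: "L \<in> borel_measurable M" unfolding L_def[abs_def] by measurable
  have "(\<integral>\<^sup>+ \<omega>. ennreal (exp (- l * Z T \<omega>)) \<partial>M) = (\<integral>\<^sup>+ \<omega>. ennreal (1 / k) * ennreal (exp (L \<omega>)) \<partial>M)"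
    unfolding Lk using k by (subst ennreal_mult) auto
  also have "\<dots> = ennreal (1 / k) * (\<integral>\<^sup>+ \<omega>. ennreal (exp (L \<omega>)) \<partial>M)"
    by (rule nn_integral_cmult) measurable
  also have "\<dots> \<le> ennreal (1 / k) * 1" by (intro mult_left_mono \<open>(\<integral>\<^sup>+ \<omega>. ennreal (exp (L \<omega>)) \<partial>M) \<le> 1\<close>) simp
  also have "1 / k = exp (- (u 0 * x\<^sup>2 + \<delta> / 2 * ln (1 + 2 * l * T)))"
    unfolding k_def exp_minus by (rule inverse_eq_divide[symmetric])
  also have "\<dots> = (1 + 2 * l * T) powr (- \<delta> / 2) * exp (- l * x\<^sup>2 / (1 + 2 * l * T))"
  proof -
    have D: "1 + 2 * l * T \<noteq> 0" using den[of 0] T by simp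
    show ?thesis unfolding powr_def if_not_P[OF D] mult_exp_exp by (simp add: u_def)
  qed
  finally show ?thesis by simp
qed

subsection \<open>Integrating the Laplace bound\<close>

text \<open>On [0, R] the exponential is at least exp(-1), which replaces the Gamma integral.
  \<open>R\<close> stays free: the reciprocal of \<open>z\<close> gives a multiple of z^(-p), and
  for \<open>z = 0\<close> arbitrarily large \<open>R\<close> shows divergence.\<close>

lemma nn_integral_powr_exp_ge:
  fixes p z R :: real
  assumes p: "p > 0" and R: "R \<ge> 0" "R * z \<le> 1" and z: "z \<ge> 0"
  shows "ennreal (R powr p * exp (- 1) / p) \<le> (\<integral>\<^sup>+ l\<in>{0..}. ennreal (l powr (p - 1) * exp (- l * z)) \<partial>lborel)"
proof -
  have "((\<lambda>l. l powr (p - 1)) has_integral (R powr (p - 1 + 1) / (p - 1 + 1))) {0..R}"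
    using p R by (intro has_integral_powr_from_0) auto
  from has_integral_mult_left[OF this, of "exp (- 1)"]
  have "((\<lambda>l. l powr (p - 1) * exp (- 1)) has_integral (R powr p * exp (- 1) / p)) {0..R}" by simp
  then have "ennreal (R powr p * exp (- 1) / p) = (\<integral>\<^sup>+ l\<in>{0..R}. ennreal (l powr (p - 1) * exp (- 1)) \<partial>lborel)"
    by (subst nn_integral_has_integral_lebesgue') auto
  also have "\<dots> \<le> (\<integral>\<^sup>+ l\<in>{0..}. ennreal (l powr (p - 1) * exp (- l * z)) \<partial>lborel)"
  proof (intro nn_integral_mono)
    fix l
    show "ennreal (l powr (p - 1) * exp (- 1)) * indicator {0..R} l \<le> ennreal (l powr (p - 1) * exp (- l * z)) * indicator {0..} l"
    proof (cases "l \<in> {0..R}")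
      case True
      then have "l * z \<le> R * z" using z by (intro mult_right_mono) auto
      then have "exp (- 1) \<le> exp (- l * z)" using R by simp
      then show ?thesis using True by (auto intro!: ennreal_leI mult_left_mono)
    qed simp
  qed
  finally show ?thesis .
qed

text \<open>Where the payoff is positive, \<open>K\<close> is below w^(-2 \<nu>), and raising this
  to the power (p - \<nu>)/\<nu> \<ge> 0 bounds w^(-2 \<nu>) by a constant times w^(-2 p). The
  factor \<open>p * exp 1\<close> undoes the constant of
  \<open>nn_integral_powr_exp_ge\<close>.\<close>

lemma payoff_le_nn_integral:
  fixes \<nu> p K w :: real
  assumes \<nu>: "\<nu> > 0" and p: "p \<ge> \<nu>" and K: "K > 0" and w: "w \<ge> 0"
  shows "e2ennreal (max (1 / ereal (w powr (2 * \<nu>)) - ereal K) 0) \<le>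
     ennreal (K powr (- (p - \<nu>) / \<nu>) * p * exp 1) * (\<integral>\<^sup>+ l\<in>{0..}. ennreal (l powr (p - 1) * exp (- l * w\<^sup>2)) \<partial>lborel)"
    (is "_ \<le> ennreal ?C * ?J")
proof (cases "w = 0")
  case True
  have C: "?C > 0" using K \<nu> p by auto
  \<comment> \<open>At \<open>w = 0\<close> the payoff is infinite, since 1/0 is infinite in
    \<open>ereal\<close>, so the right side must be infinite too.\<close>
  have "?J = \<top>"
  proof (rule ccontr)
    assume "?J \<noteq> \<top>"
    then obtain r where r: "?J = ennreal r" "r \<ge> 0" by (cases ?J) auto
    \<comment> \<open>Chosen so that the lower bound for \<open>?J\<close> becomes
      \<open>r + 1\<close>.\<close>
    define R where "R = (p * exp 1 * (r + 1)) powr (1 / p)"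
    have "ennreal (R powr p * exp (- 1) / p) \<le> ?J"
      using nn_integral_powr_exp_ge[of p R "w\<^sup>2"] True \<nu> p by (simp add: R_def)
    also have "R powr p = p * exp 1 * (r + 1)" using r \<nu> p by (simp add: R_def powr_powr)
    also have "p * exp 1 * (r + 1) * exp (- 1) / p = r + 1" using \<nu> p by (simp add: exp_minus)
    finally have "ennreal (r + 1) \<le> ennreal r" unfolding r .
    then show False using r by (simp add: ennreal_le_iff del: ennreal_plus)
  qed
  then show ?thesis using C K \<nu> p by (simp add: ennreal_mult_top)
next
  case False
  then have w0: "w > 0" using w by simp
  have wpos: "w powr (2 * \<nu>) > 0" using w0 by simp
  have lhs: "max (1 / ereal (w powr (2 * \<nu>)) - ereal K) 0 = ereal (max (1 / w powr (2 * \<nu>) - K) 0)"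
    using wpos by (simp add: one_ereal_def max_def)
  have J: "ennreal (w powr (- 2 * p) * exp (- 1) / p) \<le> ?J"
  proof -
    have "(inverse (w\<^sup>2)) powr p = w powr (- 2 * p)"
      using w0 by (simp add: powr_minus inverse_powr powr_powr flip: powr_numeral)
    then show ?thesis using nn_integral_powr_exp_ge[of p "inverse (w\<^sup>2)" "w\<^sup>2"] w0 \<nu> p by simp
  qed
  have real: "max (1 / w powr (2 * \<nu>) - K) 0 \<le> ?C * (w powr (- 2 * p) * exp (- 1) / p)"
  proof (cases "1 / w powr (2 * \<nu>) \<le> K")
    case True
    then show ?thesis using \<nu> p by (simp add: max_def)
  next
    case False
    have "1 / w powr (2 * \<nu>) = w powr (- 2 * \<nu>)" using w0 by (simp add: powr_minus divide_inverse)
    with False have "K \<le> w powr (- 2 * \<nu>)" by simp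
    then have "K powr ((p - \<nu>) / \<nu>) \<le> (w powr (- 2 * \<nu>)) powr ((p - \<nu>) / \<nu>)"
      using K \<nu> p by (intro powr_mono2) auto
    also have "\<dots> = w powr (- 2 * (p - \<nu>))"
    proof -
      have "- 2 * \<nu> * ((p - \<nu>) / \<nu>) = - 2 * (p - \<nu>)" using \<nu> by simp
      then show ?thesis by (simp only: powr_powr)
    qed
    finally have A: "K powr ((p - \<nu>) / \<nu>) \<le> w powr (- 2 * (p - \<nu>))" .
    have "- (p - \<nu>) / \<nu> + (p - \<nu>) / \<nu> = 0" by (simp only: minus_divide_left[symmetric] left_minus)
    then have "K powr (- (p - \<nu>) / \<nu>) * K powr ((p - \<nu>) / \<nu>) = 1"
      using K by (simp only: powr_add[symmetric]) simp
    then have "1 \<le> K powr (- (p - \<nu>) / \<nu>) * w powr (- 2 * (p - \<nu>))"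
      using mult_left_mono[OF A, of "K powr (- (p - \<nu>) / \<nu>)"] by simp
    then have "w powr (- 2 * \<nu>) * 1 \<le> w powr (- 2 * \<nu>) * (K powr (- (p - \<nu>) / \<nu>) * w powr (- 2 * (p - \<nu>)))"
      by (intro mult_left_mono) auto
    also have "\<dots> = K powr (- (p - \<nu>) / \<nu>) * w powr (- 2 * p)"
    proof -
      have "w powr (- 2 * \<nu>) * w powr (- 2 * (p - \<nu>)) = w powr (- 2 * p)"
        using w0 by (simp add: powr_add[symmetric] algebra_simps)
      then show ?thesis by (simp add: mult_ac)
    qed
    also have "\<dots> = ?C * (w powr (- 2 * p) * exp (- 1) / p)" using \<nu> p by (simp add: exp_minus)
    finally show ?thesis
      using False K \<open>1 / w powr (2 * \<nu>) = w powr (- 2 * \<nu>)\<close> by (simp add: max_def)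
  qed
  have "e2ennreal (max (1 / ereal (w powr (2 * \<nu>)) - ereal K) 0) = ennreal (max (1 / w powr (2 * \<nu>) - K) 0)"
    unfolding lhs by (rule e2ennreal_ereal)
  also have "\<dots> \<le> ennreal (?C * (w powr (- 2 * p) * exp (- 1) / p))" by (intro ennreal_leI real)
  also have "\<dots> = ennreal ?C * ennreal (w powr (- 2 * p) * exp (- 1) / p)"
    using \<nu> p by (intro ennreal_mult) auto
  also have "\<dots> \<le> ennreal ?C * ?J" by (intro mult_left_mono J) simp
  finally show ?thesis .
qed

section \<open>Elementary integrals and the finite double integral\<close>

lemma nn_integral_powr_affine:
  fixes l r :: real
  assumes l: "l > 0" and r: "r > 1"
  shows "(\<integral>\<^sup>+ t\<in>{0..}. ennreal ((1 + 2 * l * t) powr (- r)) \<partial>lborel) = ennreal (1 / (2 * l * (r - 1)))"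
proof -
  have "(\<integral>\<^sup>+ t. ennreal ((1 + 2 * l * t) powr (- r)) * indicator {0..} t \<partial>lborel) =
     ennreal (0 - (- ((1 + 2 * l * 0) powr (1 - r)) / (2 * l * (r - 1))))"
  proof (rule nn_integral_FTC_atLeast[where F = "\<lambda>t. - ((1 + 2 * l * t) powr (1 - r)) / (2 * l * (r - 1))"])
    fix t :: real assume "0 \<le> t"
    then have pos: "1 + 2 * l * t > 0" using l by (intro add_pos_nonneg) auto
    have "DERIV (\<lambda>t. (1 + 2 * l * t) powr (1 - r)) t :> (1 - r) * (1 + 2 * l * t) powr (1 - r - 1) * (2 * l)"
      by (rule DERIV_chain2[where f = "\<lambda>z. z powr (1 - r)" and g = "\<lambda>t. 1 + 2 * l * t", OF has_real_derivative_powr[OF pos]])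
        (auto intro!: derivative_eq_intros)
    then have "DERIV (\<lambda>t. - ((1 + 2 * l * t) powr (1 - r)) / (2 * l * (r - 1))) t :>
        - ((1 - r) * (1 + 2 * l * t) powr (1 - r - 1) * (2 * l)) / (2 * l * (r - 1))"
      by (intro DERIV_cdivide DERIV_minus)
    also have "- ((1 - r) * (1 + 2 * l * t) powr (1 - r - 1) * (2 * l)) = (2 * l * (r - 1)) * (1 + 2 * l * t) powr (- r)"
      by (simp add: algebra_simps)
    finally show "DERIV (\<lambda>t. - ((1 + 2 * l * t) powr (1 - r)) / (2 * l * (r - 1))) t :> (1 + 2 * l * t) powr (- r)"
      using l r by simp
  next
    have "filterlim (\<lambda>t. 1 + 2 * l * t) at_top at_top"
      using l by (intro filterlim_tendsto_add_at_top[OF tendsto_const] filterlim_tendsto_pos_mult_at_top[OF tendsto_const])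
        (auto simp: filterlim_ident)
    then have "((\<lambda>t. (1 + 2 * l * t) powr (1 - r)) \<longlongrightarrow> 0) at_top"
      using r by (intro tendsto_neg_powr) auto
    then have "((\<lambda>t. - ((1 + 2 * l * t) powr (1 - r)) / (2 * l * (r - 1))) \<longlongrightarrow> - 0 / (2 * l * (r - 1))) at_top"
      using l r by (intro tendsto_intros) auto
    then show "((\<lambda>t. - ((1 + 2 * l * t) powr (1 - r)) / (2 * l * (r - 1))) \<longlongrightarrow> 0) at_top" by simp
  qed auto
  then show ?thesis by simp
qed

lemma nn_integral_powr_atLeast_1:
  fixes a :: real
  assumes a: "a < -1"
  shows "(\<integral>\<^sup>+ l\<in>{1..}. ennreal (l powr a) \<partial>lborel) = ennreal (1 / (- a - 1))"
proof -
  have "(\<integral>\<^sup>+ l. ennreal (l powr a) * indicator {1..} l \<partial>lborel) = ennreal (0 - 1 powr (a + 1) / (a + 1))"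
  proof (rule nn_integral_FTC_atLeast[where F = "\<lambda>l. l powr (a + 1) / (a + 1)"])
    fix l :: real assume "1 \<le> l"
    then show "DERIV (\<lambda>l. l powr (a + 1) / (a + 1)) l :> l powr a"
      using a by (auto intro!: derivative_eq_intros)
  next
    have "((\<lambda>l. l powr (a + 1) / (a + 1)) \<longlongrightarrow> 0 / (a + 1)) at_top"
      using a by (intro tendsto_divide tendsto_neg_powr tendsto_const filterlim_ident) auto
    then show "((\<lambda>l. l powr (a + 1) / (a + 1)) \<longlongrightarrow> 0) at_top" by simp
  qed auto
  also have "0 - 1 powr (a + 1) / (a + 1) = 1 / (- a - 1)" using a by (simp add: field_simps)
  finally show ?thesis .
qed

text \<open>The power \<open>q\<close> of \<open>x / q \<le> exp (x / q)\<close>,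
  rearranged.\<close>

lemma exp_minus_le_powr:
  fixes x q :: real
  assumes x: "x > 0" and q: "q > 0"
  shows "exp (- x) \<le> q powr q * x powr (- q)"
proof -
  have "x / q \<le> exp (x / q)" using exp_ge_add_one_self[of "x / q"] by linarith
  then have "(x / q) powr q \<le> exp (x / q) powr q" using x q by (intro powr_mono2) auto
  also have "\<dots> = exp x" using q by (simp add: powr_def)
  finally have "x powr q \<le> exp x * q powr q" using x q by (simp add: powr_divide field_simps)
  then show ?thesis using x q by (simp add: exp_minus powr_minus field_simps)
qed

text \<open>For \<open>l \<le> 1\<close> the exponential is dropped; integrating over
  \<open>t\<close> leaves a multiple of l^(p-2), integrable at 0 because p > 1. For large
  \<open>l\<close> this fails when p is close to \<nu> + 1, and the exponential is traded for a
  factor l^(-q) at the cost of (1 + 2 l t)^q. That leaves l^(p-2-q), integrable at infinity because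
  q > p - 1, while q < \<nu> keeps the time integral finite.\<close>

lemma laplace_bound_integral_finite:
  fixes \<nu> p :: real
  assumes p: "1 < p" "p < \<nu> + 1"
  shows "(\<integral>\<^sup>+ l\<in>{0..}. \<integral>\<^sup>+ t\<in>{0..}. ennreal (l powr (p - 1) *
      ((1 + 2 * l * t) powr (- (\<nu> + 1)) * exp (- l / (1 + 2 * l * t)))) \<partial>lborel \<partial>lborel) < \<infinity>"
proof -
  \<comment> \<open>Midpoint of the interval (p - 1, \<nu>), which is nonempty since p < \<nu> +
    1.\<close>
  define q where "q = (p - 1 + \<nu>) / 2"
  have q: "q > p - 1" "q < \<nu>" "q > 0" using p by (auto simp: q_def)
  have inner: "(\<integral>\<^sup>+ t\<in>{0..}. ennreal (l powr (p - 1) *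
      ((1 + 2 * l * t) powr (- (\<nu> + 1)) * exp (- l / (1 + 2 * l * t)))) \<partial>lborel) \<le>
     ennreal (1 / (2 * \<nu>)) * (ennreal (l powr (p - 2)) * indicator {0..1} l) +
     ennreal (q powr q / (2 * (\<nu> - q))) * (ennreal (l powr (p - 2 - q)) * indicator {1..} l)"
    (is "?I \<le> ?A + ?B") if l: "l > 0" for l
  proof (cases "l \<le> 1")
    case True
    have "?I \<le> (\<integral>\<^sup>+ t. ennreal (l powr (p - 1)) * (ennreal ((1 + 2 * l * t) powr (- (\<nu> + 1))) * indicator {0..} t) \<partial>lborel)"
    proof (rule nn_integral_mono)
      fix t
      have "0 \<le> t \<Longrightarrow> exp (- l / (1 + 2 * l * t)) \<le> 1" using l by simp
      then show "ennreal (l powr (p - 1) * ((1 + 2 * l * t) powr (- (\<nu> + 1)) * exp (- l / (1 + 2 * l * t)))) * indicator {0..} t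
        \<le> ennreal (l powr (p - 1)) * (ennreal ((1 + 2 * l * t) powr (- (\<nu> + 1))) * indicator {0..} t)"
        by (auto simp: indicator_def ennreal_mult[symmetric] intro!: ennreal_leI mult_left_mono mult_left_le)
    qed
    also have "\<dots> = ennreal (l powr (p - 1)) * ennreal (1 / (2 * l * (\<nu> + 1 - 1)))"
      using nn_integral_powr_affine[OF l, of "\<nu> + 1"] p by (subst nn_integral_cmult) auto
    also have "\<dots> = ?A"
    proof -
      have "l powr (p - 1) * (1 / (2 * l * (\<nu> + 1 - 1))) = 1 / (2 * \<nu>) * l powr (p - 2)"
        using l p by (simp add: powr_diff powr_add power2_eq_square field_simps)
      then show ?thesis using True l p by (simp add: ennreal_mult[symmetric])
    qed
    finally show ?thesis by (rule order_trans) simp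
  next
    case False
    have "?I \<le> (\<integral>\<^sup>+ t. ennreal (q powr q * l powr (p - 1 - q)) * (ennreal ((1 + 2 * l * t) powr (- (\<nu> + 1 - q))) * indicator {0..} t) \<partial>lborel)"
    proof (rule nn_integral_mono)
      fix t
      show "ennreal (l powr (p - 1) * ((1 + 2 * l * t) powr (- (\<nu> + 1)) * exp (- l / (1 + 2 * l * t)))) * indicator {0..} t
        \<le> ennreal (q powr q * l powr (p - 1 - q)) * (ennreal ((1 + 2 * l * t) powr (- (\<nu> + 1 - q))) * indicator {0..} t)"
      proof (cases "t \<ge> 0")
        case True
        define D where "D = 1 + 2 * l * t"
        have D: "D > 0" using l True by (auto simp: D_def intro!: add_pos_nonneg)
        have "exp (- l / D) \<le> q powr q * (l / D) powr (- q)"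
          using exp_minus_le_powr[of "l / D" q] l D q by simp
        also have "(l / D) powr (- q) = l powr (- q) * D powr q"
          using l D by (simp add: powr_divide powr_minus field_simps)
        finally have "l powr (p - 1) * (D powr (- (\<nu> + 1)) * exp (- l / D)) \<le>
           l powr (p - 1) * (D powr (- (\<nu> + 1)) * (q powr q * (l powr (- q) * D powr q)))"
          by (intro mult_left_mono) auto
        also have "\<dots> = q powr q * (l powr (p - 1) * l powr (- q)) * (D powr (- (\<nu> + 1)) * D powr q)"
          by (simp add: mult_ac)
        also have "\<dots> = q powr q * l powr (p - 1 - q) * D powr (- (\<nu> + 1 - q))"
          by (simp add: powr_add[symmetric] algebra_simps)
        finally show ?thesis using True by (simp add: ennreal_mult[symmetric] ennreal_leI D_def)
      qed simp
    qed
    also have "\<dots> = ennreal (q powr q * l powr (p - 1 - q)) * ennreal (1 / (2 * l * (\<nu> + 1 - q - 1)))"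
      using nn_integral_powr_affine[OF l, of "\<nu> + 1 - q"] q by (subst nn_integral_cmult) auto
    also have "\<dots> = ?B"
    proof -
      have "l powr (p - 1 - q) = l powr (p - 2 - q) * l"
      proof -
        have "p - 1 - q = (p - 2 - q) + 1" by simp
        then show ?thesis using l by (simp only: powr_add powr_one)
      qed
      then have "(q powr q * l powr (p - 1 - q)) * (1 / (2 * l * (\<nu> + 1 - q - 1))) = q powr q / (2 * (\<nu> - q)) * l powr (p - 2 - q)"
        using l q by (simp add: field_simps)
      then show ?thesis using False q by (simp add: ennreal_mult[symmetric])
    qed
    finally show ?thesis by (rule order_trans) simp
  qed
  have "(\<integral>\<^sup>+ l\<in>{0..}. \<integral>\<^sup>+ t\<in>{0..}. ennreal (l powr (p - 1) *
      ((1 + 2 * l * t) powr (- (\<nu> + 1)) * exp (- l / (1 + 2 * l * t)))) \<partial>lborel \<partial>lborel) \<le>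
    (\<integral>\<^sup>+ l. ennreal (1 / (2 * \<nu>)) * (ennreal (l powr (p - 2)) * indicator {0..1} l) +
     ennreal (q powr q / (2 * (\<nu> - q))) * (ennreal (l powr (p - 2 - q)) * indicator {1..} l) \<partial>lborel)"
  proof (rule nn_integral_mono)
    fix l :: real
    show "(\<integral>\<^sup>+ t\<in>{0..}. ennreal (l powr (p - 1) *
      ((1 + 2 * l * t) powr (- (\<nu> + 1)) * exp (- l / (1 + 2 * l * t)))) \<partial>lborel) * indicator {0..} l \<le>
     ennreal (1 / (2 * \<nu>)) * (ennreal (l powr (p - 2)) * indicator {0..1} l) +
     ennreal (q powr q / (2 * (\<nu> - q))) * (ennreal (l powr (p - 2 - q)) * indicator {1..} l)"
      \<comment> \<open>At \<open>l = 0\<close> the left side vanishes because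
        \<open>0 powr (p - 1)\<close> is 0; for negative \<open>l\<close> the indicator does
        it.\<close>
      using inner[of l] by (cases l "0::real" rule: linorder_cases) auto
  qed
  also have "\<dots> = ennreal (1 / (2 * \<nu>)) * (\<integral>\<^sup>+ l\<in>{0..1}. ennreal (l powr (p - 2)) \<partial>lborel) +
     ennreal (q powr q / (2 * (\<nu> - q))) * (\<integral>\<^sup>+ l\<in>{1..}. ennreal (l powr (p - 2 - q)) \<partial>lborel)"
    by (subst nn_integral_add) (auto simp: nn_integral_cmult)
  also have "(\<integral>\<^sup>+ l\<in>{0..1}. ennreal (l powr (p - 2)) \<partial>lborel) = ennreal (1 powr (p - 2 + 1) / (p - 2 + 1))"
    using p by (intro nn_integral_has_integral_lebesgue' has_integral_powr_from_0) auto
  also have "(\<integral>\<^sup>+ l\<in>{1..}. ennreal (l powr (p - 2 - q)) \<partial>lborel) = ennreal (1 / (- (p - 2 - q) - 1))"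
    using q by (intro nn_integral_powr_atLeast_1) auto
  finally show ?thesis
    by (rule le_less_trans) (simp add: ennreal_mult_less_top)
qed

text \<open>The expectation is carried back from the path law to \<open>M\<close>, and Tonelli moves
  it inside the integral over \<open>l\<close>, where it meets the Laplace bound with x = 1 and
  \<delta>/2 = \<nu> + 1.\<close>

lemma r_fun_le_laplace_integral:
  assumes law: "bessel_law M B Z (2 * \<nu> + 2) 1 P" and \<nu>: "\<nu> > 0" and p: "p \<ge> \<nu>" and K: "K > 0" and t: "t \<ge> 0"
  shows "r_fun P (2 * \<nu> + 2) K t \<le> ennreal (K powr (- (p - \<nu>) / \<nu>) * p * exp 1) *
    (\<integral>\<^sup>+ l\<in>{0..}. ennreal (l powr (p - 1) * ((1 + 2 * l * t) powr (- (\<nu> + 1)) * exp (- l / (1 + 2 * l * t)))) \<partial>lborel)"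
proof -
  have sol: "squared_bessel_strong_solution M B (2 * \<nu> + 2) 1 Z" and P: "P = sqrt_law M Z"
    using law by (auto simp: bessel_law_def)
  then have BM: "brownian_motion M B" by (simp add: squared_bessel_strong_solution_def)
  interpret prob_space M using BM by (simp add: brownian_motion_def)
  have Zm[measurable]: "Z t \<in> borel_measurable M"
    using measurable_brownian_filtration_imp[OF BM, of "Z t" t] sol t by (auto simp: squared_bessel_strong_solution_def)
  have Zp: "0 \<le> Z t \<omega>" if "\<omega> \<in> space M" for \<omega>
    using sol t that by (auto simp: squared_bessel_strong_solution_def)
  let ?g = "\<lambda>w. e2ennreal (max (1 / ereal (w powr (2 * \<nu>)) - ereal K) 0)"
  let ?C = "K powr (- (p - \<nu>) / \<nu>) * p * exp 1"
  have [measurable]: "(\<lambda>w. w t) \<in> borel_measurable path_space"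
    unfolding path_space_def by (intro measurable_restrict_space1 measurable_component_singleton) (use t in auto)
  have "r_fun P (2 * \<nu> + 2) K t = (\<integral>\<^sup>+ w. ?g (w t) \<partial>distr M path_space (\<lambda>\<omega>. \<lambda>t\<in>{0..}. sqrt (Z t \<omega>)))"
    by (simp add: r_fun_def P sqrt_law_def)
  also have "\<dots> = (\<integral>\<^sup>+ \<omega>. ?g (sqrt (Z t \<omega>)) \<partial>M)"
    using t by (subst nn_integral_distr[OF measurable_sqrt_path[OF sol]]) auto
  also have "\<dots> \<le> (\<integral>\<^sup>+ \<omega>. ennreal ?C * (\<integral>\<^sup>+ l\<in>{0..}. ennreal (l powr (p - 1) * exp (- l * Z t \<omega>)) \<partial>lborel) \<partial>M)"
    using payoff_le_nn_integral[OF \<nu> p K, of "sqrt (Z t \<omega>)" for \<omega>] Zp by (intro nn_integral_mono) auto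
  also have "\<dots> = ennreal ?C * (\<integral>\<^sup>+ \<omega>. (\<integral>\<^sup>+ l\<in>{0..}. ennreal (l powr (p - 1) * exp (- l * Z t \<omega>)) \<partial>lborel) \<partial>M)"
    by (rule nn_integral_cmult) measurable
  also have "(\<integral>\<^sup>+ \<omega>. (\<integral>\<^sup>+ l\<in>{0..}. ennreal (l powr (p - 1) * exp (- l * Z t \<omega>)) \<partial>lborel) \<partial>M) =
      (\<integral>\<^sup>+ l. (\<integral>\<^sup>+ \<omega>. ennreal (l powr (p - 1) * exp (- l * Z t \<omega>)) * indicator {0..} l \<partial>M) \<partial>lborel)"
  proof -
    interpret pair_sigma_finite lborel M ..
    show ?thesis by (rule Fubini') measurable
  qed
  also have "\<dots> \<le> (\<integral>\<^sup>+ l\<in>{0..}. ennreal (l powr (p - 1) * ((1 + 2 * l * t) powr (- (\<nu> + 1)) * exp (- l / (1 + 2 * l * t)))) \<partial>lborel)"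
  proof (rule nn_integral_mono)
    fix l :: real
    show "(\<integral>\<^sup>+ \<omega>. ennreal (l powr (p - 1) * exp (- l * Z t \<omega>)) * indicator {0..} l \<partial>M) \<le>
      ennreal (l powr (p - 1) * ((1 + 2 * l * t) powr (- (\<nu> + 1)) * exp (- l / (1 + 2 * l * t)))) * indicator {0..} l"
    proof (cases "0 \<le> l")
      case True
      have "(\<integral>\<^sup>+ \<omega>. ennreal (l powr (p - 1) * exp (- l * Z t \<omega>)) * indicator {0..} l \<partial>M) =
          ennreal (l powr (p - 1)) * (\<integral>\<^sup>+ \<omega>. ennreal (exp (- l * Z t \<omega>)) \<partial>M)"
        using True by (subst nn_integral_cmult[symmetric]) (auto simp: ennreal_mult)
      also have "\<dots> \<le> ennreal (l powr (p - 1)) *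
          ennreal ((1 + 2 * l * t) powr (- (2 * \<nu> + 2) / 2) * exp (- l * 1\<^sup>2 / (1 + 2 * l * t)))"
        by (intro mult_left_mono squared_bessel_laplace_le[OF sol t True]) simp
      also have "- (2 * \<nu> + 2) / 2 = - (\<nu> + 1)" by (simp add: field_simps)
      finally show ?thesis using True by (simp add: ennreal_mult[symmetric])
    qed simp
  qed
  finally show ?thesis by (simp add: mult_left_mono)
qed

theorem mainTheorem7:
  fixes \<delta> K :: real
    and M :: "'a measure"
    and B Z :: "real \<Rightarrow> 'a \<Rightarrow> real"
    and P :: "(real \<Rightarrow> real) measure"
  assumes "\<delta> > 2"
    and "K > 0"
    and "bessel_law M B Z \<delta> 1 P"
  shows "(\<integral>\<^sup>+ t\<in>{0..}. r_fun P \<delta> K t \<partial>lborel) < \<infinity>"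
proof -
  define \<nu> where "\<nu> = (\<delta> - 2) / 2"
  \<comment> \<open>1 + \<nu>/2 is the midpoint of (1, \<nu> + 1); the maximum adds
    \<open>p \<ge> \<nu>\<close> and stays below \<nu> + 1.\<close>
  define p where "p = max \<nu> (1 + \<nu> / 2)"
  have \<nu>: "\<nu> > 0" and \<delta>: "\<delta> = 2 * \<nu> + 2" using assms(1) by (auto simp: \<nu>_def field_simps)
  have p: "p \<ge> \<nu>" "1 < p" "p < \<nu> + 1" using \<nu> by (auto simp: p_def)
  define C where "C = K powr (- (p - \<nu>) / \<nu>) * p * exp 1"
  let ?k = "\<lambda>l t. ennreal (l powr (p - 1) * ((1 + 2 * l * t) powr (- (\<nu> + 1)) * exp (- l / (1 + 2 * l * t))))"
  have "(\<integral>\<^sup>+ t\<in>{0..}. r_fun P \<delta> K t \<partial>lborel) \<le>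
      (\<integral>\<^sup>+ t. ennreal C * (\<integral>\<^sup>+ l. ?k l t * indicator {0..} l * indicator {0..} t \<partial>lborel) \<partial>lborel)"
  proof (rule nn_integral_mono)
    fix t :: real
    show "r_fun P \<delta> K t * indicator {0..} t \<le> ennreal C * (\<integral>\<^sup>+ l. ?k l t * indicator {0..} l * indicator {0..} t \<partial>lborel)"
      using r_fun_le_laplace_integral[OF assms(3)[unfolded \<delta>] \<nu> p(1) assms(2), of t] by (auto simp: indicator_def \<delta> C_def)
  qed
  also have "\<dots> = ennreal C * (\<integral>\<^sup>+ t. \<integral>\<^sup>+ l. ?k l t * indicator {0..} l * indicator {0..} t \<partial>lborel \<partial>lborel)"
    by (rule nn_integral_cmult) measurable
  \<comment> \<open>Time is moved inside because for fixed \<open>l\<close> its integral is explicit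
    after the bounds on the exponential.\<close>
  also have "(\<integral>\<^sup>+ t. \<integral>\<^sup>+ l. ?k l t * indicator {0..} l * indicator {0..} t \<partial>lborel \<partial>lborel) =
      (\<integral>\<^sup>+ l. \<integral>\<^sup>+ t. ?k l t * indicator {0..} l * indicator {0..} t \<partial>lborel \<partial>lborel)"
    by (rule lborel_pair.Fubini') measurable
  also have "\<dots> = (\<integral>\<^sup>+ l\<in>{0..}. \<integral>\<^sup>+ t\<in>{0..}. ?k l t \<partial>lborel \<partial>lborel)"
    by (intro nn_integral_cong) (auto simp: indicator_def)
  also have "ennreal C * \<dots> < \<infinity>"
    using laplace_bound_integral_finite[OF p(2,3)] ennreal_less_top[of C]
    unfolding infinity_ennreal_def ennreal_mult_less_top by blast
  finally show ?thesis .
qed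

end
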